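(* Let $d\in\mathbb{Z}$, let $(A,\mu_A,\partial_A)$ and $(B,\mu_B,\partial_B)$ be double Poisson dg algebras with brackets $\{\!\{\,,\}\!\}_A$ and $\{\!\{\,,\}\!\}_B$ of degree $-d$, and let $\phi:A\to B$ be a morphism of double Poisson dg algebras. Let $\{m^A_n\}_{n\in\mathbb{N}}$ and $\{m^B_n\}_{n\in\mathbb{N}}$ be the corresponding cyclic $A_\infty$-algebra structures on $\partial_{d-1}A=A\oplus A^{\#}[d-1]$ and $\partial_{d-1}B=B\oplus B^{\#}[d-1]$ (see context). Consider the dg algebra $\partial_{d-1}\phi=A\oplus B^{\#}[d-1]$, with differential $m_1^\phi$, product $m_2^\phi$ and bilinear form $\gamma_\phi$, and define $m_3^\phi:(\partial_{d-1}\phi)^{\otimes3}\to\partial_{d-1}\phi$ as the unique good map satisfying $$m_3^\phi(a,tf,b)=m_3^A\big(a,t(f\circ\phi),b\big)\quad\text{and}\quad m_3^\phi(tf,b,tg)=m_3^B\big(tf,\phi(b),tg\big)$$ for all homogeneous $a,b\in A$ and $f,g\in B^{\#}$; set $m_n^\phi=0$ for $n\ge4$. Then $\partial_{d-1}\phi$, with $\{m_n^\phi\}_{n\in\mathbb{N}}$ and $\gamma_\phi$, is a fully manageable nice degenerate $(d-1)$-cyclic $A_\infty$-algebra, and the maps $$\Phi_A:\partial_{d-1}\phi\to\partial_{d-1}A,\ (a,tf)\mapsto(a,t(f\circ\phi)),\qquad \Phi_B:\partial_{d-1}\phi\to\partial_{d-1}B,\ (a,tf)\mapsto(\phi(a),tf)$$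 for $a\in A$, $f\in B^{\#}$, are strict morphisms of $A_\infty$-algebras preserving the corresponding bilinear forms, i.e. $\gamma_\phi=\gamma_A\circ\Phi_A^{\otimes2}=\gamma_B\circ\Phi_B^{\otimes2}$.
   Context: **General conventions.** $\Bbbk$ is a field of characteristic zero; tensor products are over $\Bbbk$; $\mathbb{N}=\{1,2,\dots\}$. Gradings are cohomological by $\mathbb{Z}$; $V[m]^n=V^{n+m}$, and if $V$ is dg then $\partial_{V[m]}=(-1)^m\partial_V$. $s_V^m:V\to V[m]$ is the map with underlying identity (so $|s^m_Vv|=|v|-m$); for $f$ of degree $0$, $f[m]$ has the same underlying map as $f$. Koszul sign rule: $(f\otimes g)(v\otimes w)=(-1)^{|g||v|}f(v)\otimes g(w)$. $\tau_{V,W}(v\otimes w)=(-1)^{|v||w|}w\otimes v$, and for $\sigma\in\mathbb{S}_n$, $\tau_{V,n}(\sigma)(v_1\otimes\dots\otimes v_n)=(-1)^{\epsilon}v_{\sigma^{-1}(1)}\otimes\dots\otimes v_{\sigma^{-1}(n)}$ with $\epsilon=\sum_{i<j,\ \sigma^{-1}(i)>\sigma^{-1}(j)}|v_{\sigma^{-1}(i)}||v_{\sigma^{-1}(j)}|$. $V^{\#}=\mathcal{H}om(V,\Bbbk)$ is the graded dual, with differential $f\mapsto-(-1)^{|f|}f\circ\partial_V$. Algebras are not assumed unital. **Double Poisson bracket of degree $-d$** on a dg algebra $(A,\mu_A,\partial_A)$: a homogeneous linear map $\{\!\{\,,\}\!\}_A:A[d]\otimes A[d]\to A\otimes A$ of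 degree $d$ with $(\partial_A\otimes\mathrm{id}+\mathrm{id}\otimes\partial_A)\circ\{\!\{\,,\}\!\}_A=(-1)^d\{\!\{\,,\}\!\}_A\circ(\partial_{A[d]}\otimes\mathrm{id}+\mathrm{id}\otimes\partial_{A[d]})$ such that: (i) $-\{\!\{\,,\}\!\}_A\circ\tau_{A[d],A[d]}=\tau_{A,A}\circ\{\!\{\,,\}\!\}_A$; (ii) for each homogeneous $a\in A$, the map $\mathrm{AD}(a):A\to A\otimes A$, $b\mapsto\{\!\{s^da,s^db\}\!\}_A$, of degree $|a|-d$, satisfies $\mathrm{AD}(a)\circ\mu_A=(\mathrm{id}\otimes\mu_A)\circ(\mathrm{AD}(a)\otimes\mathrm{id})+(\mu_A\otimes\mathrm{id})\circ(\mathrm{id}\otimes\mathrm{AD}(a))$; (iii) $\sum_{\sigma\in C_3}\tau_{A,3}(\sigma)\circ\{\!\{\,,\,,\}\!\}_{A,L}\circ\tau_{A[d],3}(\sigma^{-1})=0$, where $C_3\subseteq\mathbb{S}_3$ is the subgroup of cyclic permutations and $\{\!\{\,,\,,\}\!\}_{A,L}=(\{\!\{\,,\}\!\}_A\otimes\mathrm{id}_A)\circ(\mathrm{id}_{A[d]}\otimes s_A^d\otimes\mathrm{id}_A)\circ(\mathrm{id}_{A[d]}\otimes\{\!\{\,,\}\!\}_A)$. On elements $a,b\in A$ one writes $\{\!\{a,b\}\!\}_A$ for $\{\!\{s^da,s^db\}\!\}_A$. A *double Poisson dg algebra* is a dg algebra with such a bracket; a *morphism* $\phi:A\to B$ is a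 morphism of dg algebras with $(\phi\otimes\phi)\circ\{\!\{\,,\}\!\}_A=\{\!\{\,,\}\!\}_B\circ(\phi[d]\otimes\phi[d])$. **$A_\infty$-algebras.** A (nonunitary) $A_\infty$-algebra is a graded space $E$ with maps $m_n:E^{\otimes n}\to E$, $n\in\mathbb{N}$, of degree $2-n$ with $\sum_{r+s+t=n,\ s\geq1,\ r,t\ge0}(-1)^{r+st}m_{r+1+t}\circ(\mathrm{id}^{\otimes r}\otimes m_s\otimes\mathrm{id}^{\otimes t})=0$ for all $n\in\mathbb{N}$. It is *fully manageable* if $(E,m_2,m_1)$ is a dg algebra; *small* if $m_n=0$ for $n\ge4$; *essentially odd* if $m_{2i}=0$ for all $i>1$. A *strict morphism* $E\to E'$ is a degree $0$ linear map $f$ with $f\circ m_n=m'_n\circ f^{\otimes n}$ for all $n$. It is *degenerate $e$-cyclic* for a (not necessarily nondegenerate) bilinear form $\gamma:E\otimes E\to\Bbbk$ of degree $e$ if $\gamma\circ\tau_{E,E}=\gamma$ and $\gamma(m_n(a_1,\dots,a_n),a_0)=(-1)^{n+|a_0|\sum_{i=1}^n|a_i|}\gamma(m_n(a_0,\dots,a_{n-1}),a_n)$ for all $n$ and homogeneous $a_i\in E$; it is *$e$-cyclic* if moreover $\gamma$ is nondegenerate. **Good, nice.** Let $E=E_0\oplus E_1$. For odd $n$, let $\mathscr{I}_n$ be the set of $(i_1,\dots,i_n)\in\{0,1\}^n$ with $i_j\ne i_{j+1}$ for all $j$. A map $m_n:E^{\otimes n}\to E$ is *good* if it vanishes on $E_{i_1}\otimes\dots\otimes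 E_{i_n}$ for $(i_1,\dots,i_n)\notin\mathscr{I}_n$ and sends $E_{i_1}\otimes\dots\otimes E_{i_n}$ into $E_{i_1}$ for $(i_1,\dots,i_n)\in\mathscr{I}_n$. An $A_\infty$-structure on $E$ is *good* if it is essentially odd and $m_n$ is good for every odd $n$; *nice* if good and small. The decompositions used are $\partial_{d-1}A=A\oplus A^{\#}[d-1]$ and $\partial_{d-1}\phi=A\oplus B^{\#}[d-1]$ (first summand $E_0$, second $E_1$). **Dg algebras $\partial_{d-1}A$ and $\partial_{d-1}\phi$.** Write $tf=s^{d-1}f$ for $f\in A^{\#}$ or $B^{\#}$. For a dg $A$-bimodule $M$, $M^{\#}$ is a dg bimodule via $(a\cdot f\cdot b)(c)=(-1)^{|a|(|f|+|b|+|c|)}f(b\cdot c\cdot a)$, $M[k]$ is one via $a\cdot s^km\cdot b=(-1)^{k|a|}s^k(a\cdot m\cdot b)$, and $A\oplus M$ is a dg algebra with product $(a,m)(a',m')=(aa',m\cdot a'+a\cdot m')$ and direct sum differential. This gives the dg algebra $\partial_{d-1}A=A\oplus A^{\#}[d-1]$ and, viewing $B$ as a dg $A$-bimodule through $\phi$, the dg algebra $\partial_{d-1}\phi=A\oplus B^{\#}[d-1]$. **Bilinear forms** (of degree $d-1$). On $\partial_{d-1}A$: $\gamma_A(tf,a)=(-1)^{|a||tf|}\gamma_A(a,tf)=f(a)$, $\gamma_A(a,b)=\gamma_A(tf,tg)=0$. On $\partial_{d-1}\phi$: $\gamma_\phi(tf,a)=(-1)^{|a|(|f|-d+1)}\gamma_\phi(a,tf)=f(\phi(a))$,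 $\gamma_\phi(a,b)=\gamma_\phi(tf,tg)=0$. **Corresponding structure on $\partial_{d-1}A$.** A double Poisson bracket of degree $-d$ on $A$ corresponds (bijectively) to the unique nice $(d-1)$-cyclic $A_\infty$-structure $\{m_n^A\}$ on $\partial_{d-1}A$ for $\gamma_A$ such that $m_n^A(A^{\otimes n})\subseteq A$ for all $n$, $m_1^A,m_2^A$ are the differential and product of the dg algebra $\partial_{d-1}A$, and $(f\otimes g)(\{\!\{a,b\}\!\}_A)=(-1)^{|b|(|a|+|g|+1)}\gamma_A(m_3^A(b,tg,a),tf)$ for all homogeneous $a,b\in A$, $f,g\in A^{\#}$. Similarly for $B$. *)

theory Defs
  imports
    Complex_Main
    "HOL-Library.Function_Algebras"
    "HOL-Library.Product_Plus"
    "HOL-Library.Poly_Mapping"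
begin

section \<open>Graded vector spaces\<close>

text \<open>A graded space is a scalar multiplication on an ambient abelian group together with its
  homogeneous components; the space itself is the (internal direct) sum of the components,
  \<open>gcarrier\<close>, which need not be the whole ambient type: the graded dual is in general a proper subspace of
  the space of all functions.\<close>

record ('k, 'v) gvs =
  scl :: "'k \<Rightarrow> 'v \<Rightarrow> 'v"
  grade :: "int \<Rightarrow> 'v set"

definition is_decomp :: "('k, 'v::ab_group_add) gvs \<Rightarrow> 'v \<Rightarrow> (int \<Rightarrow> 'v) \<Rightarrow> bool" where
  "is_decomp V x c \<longleftrightarrow>
     (\<forall>n. c n \<in> grade V n) \<and> finite {n. c n \<noteq> 0} \<and> x = (\<Sum>n | c n \<noteq> 0. c n)"

definition gcarrier :: "('k, 'v::ab_group_add) gvs \<Rightarrow> 'v set" where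
  "gcarrier V = {x. \<exists>c. is_decomp V x c}"

definition graded_space :: "('k::field, 'v::ab_group_add) gvs \<Rightarrow> bool" where
  "graded_space V \<longleftrightarrow>
     vector_space (scl V) \<and>
     (\<forall>n. module.subspace (scl V) (grade V n)) \<and>
     (\<forall>x c c'. is_decomp V x c \<and> is_decomp V x c' \<longrightarrow> c = c')"

text \<open>The homogeneous component of degree \<open>n\<close> of an element, and the degrees occurring in it.\<close>

definition part :: "('k, 'v::ab_group_add) gvs \<Rightarrow> int \<Rightarrow> 'v \<Rightarrow> 'v" where
  "part V n x = (THE c. is_decomp V x c) n"

definition degs :: "('k, 'v::ab_group_add) gvs \<Rightarrow> 'v \<Rightarrow> int set" where
  "degs V x = {n. part V n x \<noteq> 0}"

text \<open>\<open>sg n x\<close> is $(-1)^n x$.\<close>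

definition sg :: "int \<Rightarrow> 'v::ab_group_add \<Rightarrow> 'v" where
  "sg n x = (if even n then x else - x)"

text \<open>Formulas with Koszul signs are stated on homogeneous elements, the degree \<open>n\<close> being passed
  explicitly to the formula \<open>F\<close>; \<open>hlin\<close> and \<open>hmulti\<close> extend them (multi)additively to sums of
  homogeneous elements.\<close>

definition hlin ::
  "('k, 'v::ab_group_add) gvs \<Rightarrow> (int \<Rightarrow> 'v \<Rightarrow> 'w::comm_monoid_add) \<Rightarrow> 'v \<Rightarrow> 'w" where
  "hlin V F x = (\<Sum>n\<in>degs V x. F n (part V n x))"

primrec hmulti ::
  "('k, 'v::ab_group_add) gvs list \<Rightarrow> (int list \<Rightarrow> 'v list \<Rightarrow> 'w::comm_monoid_add) \<Rightarrow> 'v list \<Rightarrow> 'w"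
where
  "hmulti [] F xs = F [] []"
| "hmulti (V # Vs) F xs =
     hlin V (\<lambda>n x. hmulti Vs (\<lambda>ns ys. F (n # ns) (x # ys)) (tl xs)) (hd xs)"

text \<open>$V[m]^n = V^{n+m}$; the suspension $s_V^m$ is the identity of the ambient type.\<close>

definition shift :: "int \<Rightarrow> ('k, 'v) gvs \<Rightarrow> ('k, 'v) gvs" where
  "shift m V = \<lparr>scl = scl V, grade = (\<lambda>n. grade V (n + m))\<rparr>"

definition shift_dif :: "int \<Rightarrow> ('v::ab_group_add \<Rightarrow> 'v) \<Rightarrow> 'v \<Rightarrow> 'v" where
  "shift_dif m \<delta> = (\<lambda>x. sg m (\<delta> x))"

definition ground :: "('k::field, 'k) gvs" where
  "ground = \<lparr>scl = (*), grade = (\<lambda>n. if n = 0 then UNIV else {0})\<rparr>"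

definition dsum :: "('k, 'v) gvs \<Rightarrow> ('k, 'w) gvs \<Rightarrow> ('k, 'v \<times> 'w) gvs" where
  "dsum V W = \<lparr>scl = (\<lambda>c (x, y). (scl V c x, scl W c y)),
               grade = (\<lambda>n. grade V n \<times> grade W n)\<rparr>"

definition gmap ::
  "int \<Rightarrow> ('k, 'v::ab_group_add) gvs \<Rightarrow> ('k, 'w::ab_group_add) gvs \<Rightarrow> ('v \<Rightarrow> 'w) \<Rightarrow> bool" where
  "gmap e V W f \<longleftrightarrow>
     (\<forall>x\<in>gcarrier V. \<forall>y\<in>gcarrier V. f (x + y) = f x + f y) \<and>
     (\<forall>c. \<forall>x\<in>gcarrier V. f (scl V c x) = scl W c (f x)) \<and>
     (\<forall>n. f ` grade V n \<subseteq> grade W (n + e))"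

text \<open>Linear maps $V^{\otimes n} \to W$ are given as \<open>n\<close>-linear maps on lists of length \<open>n\<close>.\<close>

definition multilinear ::
  "nat \<Rightarrow> ('k, 'v::ab_group_add) gvs \<Rightarrow> ('k, 'w::ab_group_add) gvs \<Rightarrow> ('v list \<Rightarrow> 'w) \<Rightarrow> bool" where
  "multilinear n V W f \<longleftrightarrow>
     (\<forall>xs. length xs = n \<and> set xs \<subseteq> gcarrier V \<longrightarrow>
        f xs \<in> gcarrier W \<and>
        (\<forall>i<n. (\<forall>y\<in>gcarrier V. f (xs[i := xs ! i + y]) = f xs + f (xs[i := y])) \<and>
               (\<forall>c. f (xs[i := scl V c (xs ! i)]) = scl W c (f xs))))"

definition homog :: "('k, 'v) gvs \<Rightarrow> int list \<Rightarrow> 'v list \<Rightarrow> bool" where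
  "homog V ds xs \<longleftrightarrow> list_all2 (\<lambda>d x. x \<in> grade V d) ds xs"

definition has_degree ::
  "nat \<Rightarrow> int \<Rightarrow> ('k, 'v) gvs \<Rightarrow> ('k, 'w) gvs \<Rightarrow> ('v list \<Rightarrow> 'w) \<Rightarrow> bool" where
  "has_degree n e V W f \<longleftrightarrow>
     (\<forall>ds xs. length xs = n \<and> homog V ds xs \<longrightarrow> f xs \<in> grade W (sum_list ds + e))"

definition graded_form ::
  "int \<Rightarrow> ('k::field, 'v::ab_group_add) gvs \<Rightarrow> ('v \<Rightarrow> 'v \<Rightarrow> 'k) \<Rightarrow> bool" where
  "graded_form e V \<gamma> \<longleftrightarrow>
     multilinear 2 V ground (\<lambda>xs. \<gamma> (xs ! 0) (xs ! 1)) \<and>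
     has_degree 2 e V ground (\<lambda>xs. \<gamma> (xs ! 0) (xs ! 1))"

definition dg_algebra ::
  "('k::field, 'v::ab_group_add) gvs \<Rightarrow> ('v \<Rightarrow> 'v \<Rightarrow> 'v) \<Rightarrow> ('v \<Rightarrow> 'v) \<Rightarrow> bool" where
  "dg_algebra V \<mu> \<delta> \<longleftrightarrow>
     graded_space V \<and>
     gmap 1 V V \<delta> \<and>
     multilinear 2 V V (\<lambda>xs. \<mu> (xs ! 0) (xs ! 1)) \<and>
     has_degree 2 0 V V (\<lambda>xs. \<mu> (xs ! 0) (xs ! 1)) \<and>
     (\<forall>x\<in>gcarrier V. \<delta> (\<delta> x) = 0) \<and>
     (\<forall>x\<in>gcarrier V. \<forall>y\<in>gcarrier V. \<forall>z\<in>gcarrier V. \<mu> (\<mu> x y) z = \<mu> x (\<mu> y z)) \<and>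
     (\<forall>n. \<forall>x\<in>grade V n. \<forall>y\<in>gcarrier V. \<delta> (\<mu> x y) = \<mu> (\<delta> x) y + sg n (\<mu> x (\<delta> y)))"


section \<open>Tensor powers\<close>

text \<open>For a space \<open>V\<close> filling its ambient type, $V^{\otimes n}$ is the quotient of the free vector
  space on lists of length \<open>n\<close> by the multilinearity relations. Tensors are handled through formal
  sums representing them, and \<open>teq V\<close> is equality in the quotient. A shift $V[m]$ has the same
  underlying vector space, so it only enters through the degrees used for Koszul signs.\<close>

type_synonym ('k, 'v) fsum = "'v list \<Rightarrow>\<^sub>0 'k"

definition pure :: "'v list \<Rightarrow> ('k::field, 'v) fsum" where
  "pure xs = Poly_Mapping.single xs 1"

definition tscl :: "'k::field \<Rightarrow> ('k, 'v) fsum \<Rightarrow> ('k, 'v) fsum" where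
  "tscl c t = Poly_Mapping.map ((*) c) t"

definition tensor_relations :: "('k::field, 'v::ab_group_add) gvs \<Rightarrow> ('k, 'v) fsum set" where
  "tensor_relations V =
     {pure (xs @ [x + y] @ ys) - pure (xs @ [x] @ ys) - pure (xs @ [y] @ ys) | xs x y ys. True} \<union>
     {pure (xs @ [scl V c x] @ ys) - tscl c (pure (xs @ [x] @ ys)) | xs c x ys. True}"

definition teq ::
  "('k::field, 'v::ab_group_add) gvs \<Rightarrow> ('k, 'v) fsum \<Rightarrow> ('k, 'v) fsum \<Rightarrow> bool" where
  "teq V t u \<longleftrightarrow> t - u \<in> module.span tscl (tensor_relations V)"

definition tensors :: "nat \<Rightarrow> ('k::field, 'v) fsum set" where
  "tensors n = {t. \<forall>xs\<in>Poly_Mapping.keys t. length xs = n}"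

definition tensor_grade ::
  "('k::field, 'v::ab_group_add) gvs \<Rightarrow> nat \<Rightarrow> int \<Rightarrow> ('k, 'v) fsum set" where
  "tensor_grade V n e =
     {t \<in> tensors n. \<exists>u \<in> tensors n. teq V t u \<and>
        (\<forall>xs\<in>Poly_Mapping.keys u. \<exists>ds. homog V ds xs \<and> sum_list ds = e)}"

text \<open>Linear extension of a map defined on lists; \<open>sc\<close> is the scalar multiplication of the
  codomain.\<close>

definition tlin ::
  "('k::field \<Rightarrow> 'w \<Rightarrow> 'w) \<Rightarrow> ('v list \<Rightarrow> 'w::comm_monoid_add) \<Rightarrow> ('k, 'v) fsum \<Rightarrow> 'w" where
  "tlin sc F t = (\<Sum>xs\<in>Poly_Mapping.keys t. sc (Poly_Mapping.lookup t xs) (F xs))"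

text \<open>\<open>slot Vs k e F\<close> is $\mathrm{id}_{V_1}\otimes\dots\otimes\mathrm{id}_{V_r}\otimes F\otimes
  \mathrm{id}\otimes\dots\otimes\mathrm{id}$ for \<open>Vs = [V_1, ..., V_r]\<close> and a map \<open>F\<close> of degree \<open>e\<close>
  on \<open>k\<close>-fold tensors; by the Koszul rule \<open>F\<close> picks up the degrees of the first \<open>r\<close> entries.\<close>

definition slot ::
  "('k::field, 'v::ab_group_add) gvs list \<Rightarrow> nat \<Rightarrow> int \<Rightarrow> ('v list \<Rightarrow> ('k, 'v) fsum) \<Rightarrow>
     ('k, 'v) fsum \<Rightarrow> ('k, 'v) fsum" where
  "slot Vs k e F =
     tlin tscl (\<lambda>xs.
       let r = length Vs in
       hmulti Vs
         (\<lambda>ds ys. sg (e * sum_list ds)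
            (tlin tscl (\<lambda>ws. pure (ys @ ws @ drop (r + k) xs)) (F (take k (drop r xs)))))
         (take r xs))"

text \<open>$\tau_{V,n}(\sigma)$, with positions numbered from \<open>0\<close>.\<close>

definition tau ::
  "('k::field, 'v::ab_group_add) gvs \<Rightarrow> nat \<Rightarrow> (nat \<Rightarrow> nat) \<Rightarrow> ('k, 'v) fsum \<Rightarrow> ('k, 'v) fsum" where
  "tau V n \<sigma> =
     tlin tscl
       (hmulti (replicate n V)
         (\<lambda>ds ys. sg (\<Sum>(i, j) \<in> {(i, j). i < j \<and> j < n \<and> inv \<sigma> i > inv \<sigma> j}.
                        ds ! (inv \<sigma> i) * ds ! (inv \<sigma> j))
                    (pure (map (\<lambda>i. ys ! (inv \<sigma> i)) [0..<n]))))"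

definition swap2 :: "nat \<Rightarrow> nat" where
  "swap2 = (\<lambda>i. if i = 0 then 1 else if i = 1 then 0 else i)"

definition cyclic3 :: "(nat \<Rightarrow> nat) set" where
  "cyclic3 = (\<lambda>k i. if i < 3 then (i + k) mod 3 else i) ` {..<3}"

definition tmap :: "('v \<Rightarrow> 'w) \<Rightarrow> ('k::field, 'v) fsum \<Rightarrow> ('k, 'w) fsum" where
  "tmap \<phi> = tlin tscl (\<lambda>xs. pure (map \<phi> xs))"

text \<open>$(f \otimes g)(x \otimes y) = (-1)^{|g||x|} f(x) g(y)$ for \<open>g\<close> of degree \<open>s\<close>.\<close>

definition tpair ::
  "('k::field, 'v::ab_group_add) gvs \<Rightarrow> int \<Rightarrow> ('v \<Rightarrow> 'k) \<Rightarrow> ('v \<Rightarrow> 'k) \<Rightarrow> ('k, 'v) fsum \<Rightarrow> 'k" where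
  "tpair V s f g = tlin (*) (\<lambda>xs. hlin V (\<lambda>n x. sg (s * n) (f x * g (xs ! 1))) (xs ! 0))"


section \<open>Double Poisson dg algebras\<close>

text \<open>A map $A[d] \otimes A[d] \to A \otimes A$ is given as \<open>br :: 'a \<Rightarrow> 'a \<Rightarrow> ('k, 'a) fsum\<close>,
  bilinear modulo \<open>teq\<close>.\<close>

definition bracket_map ::
  "('a \<Rightarrow> 'a \<Rightarrow> ('k::field, 'a) fsum) \<Rightarrow> 'a list \<Rightarrow> ('k, 'a) fsum" where
  "bracket_map br xs = br (xs ! 0) (xs ! 1)"

definition triple_bracket ::
  "int \<Rightarrow> ('k::field, 'a::ab_group_add) gvs \<Rightarrow> ('a \<Rightarrow> 'a \<Rightarrow> ('k, 'a) fsum) \<Rightarrow>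
     ('k, 'a) fsum \<Rightarrow> ('k, 'a) fsum" where
  "triple_bracket d A br =
     slot [] 2 d (bracket_map br) \<circ> slot [shift d A] 1 (- d) pure \<circ>
     slot [shift d A] 2 d (bracket_map br)"

definition double_poisson_bracket ::
  "int \<Rightarrow> ('k::field, 'a::ab_group_add) gvs \<Rightarrow> ('a \<Rightarrow> 'a \<Rightarrow> 'a) \<Rightarrow> ('a \<Rightarrow> 'a) \<Rightarrow>
     ('a \<Rightarrow> 'a \<Rightarrow> ('k, 'a) fsum) \<Rightarrow> bool" where
  "double_poisson_bracket d A \<mu> \<delta> br \<longleftrightarrow>
    (let BR = slot [] 2 d (bracket_map br);
         D = (\<lambda>xs. pure [\<delta> (xs ! 0)]);
         Dd = (\<lambda>xs. pure [shift_dif d \<delta> (xs ! 0)]);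
         M = (\<lambda>xs. pure [\<mu> (xs ! 0) (xs ! 1)])
     in
     (\<forall>a b. br a b \<in> tensors 2) \<and>
     (\<forall>a a' b. teq A (br (a + a') b) (br a b + br a' b)) \<and>
     (\<forall>a b b'. teq A (br a (b + b')) (br a b + br a b')) \<and>
     (\<forall>c a b. teq A (br (scl A c a) b) (tscl c (br a b))) \<and>
     (\<forall>c a b. teq A (br a (scl A c b)) (tscl c (br a b))) \<and>
     (\<forall>p q. \<forall>a\<in>grade (shift d A) p. \<forall>b\<in>grade (shift d A) q.
        br a b \<in> tensor_grade A 2 (p + q + d)) \<and>
     (\<forall>a b. teq A (slot [] 1 1 D (BR (pure [a, b])) + slot [A] 1 1 D (BR (pure [a, b])))
              (sg d (BR (slot [] 1 1 Dd (pure [a, b]) + slot [shift d A] 1 1 Dd (pure [a, b]))))) \<and>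
     (\<forall>a b. teq A (- BR (tau (shift d A) 2 swap2 (pure [a, b])))
              (tau A 2 swap2 (BR (pure [a, b])))) \<and>
     (\<forall>p. \<forall>a\<in>grade A p. \<forall>b c.
        let AD = (\<lambda>xs. br a (xs ! 0)) in
        teq A (br a (\<mu> b c))
          (slot [A] 2 0 M (slot [] 1 (p - d) AD (pure [b, c])) +
           slot [] 2 0 M (slot [A] 1 (p - d) AD (pure [b, c])))) \<and>
     (\<forall>a b c. teq A (\<Sum>\<sigma>\<in>cyclic3.
          tau A 3 \<sigma> (triple_bracket d A br (tau (shift d A) 3 (inv \<sigma>) (pure [a, b, c])))) 0))"

text \<open>The algebra is required to fill its ambient type.\<close>

definition double_poisson_dg_algebra ::
  "int \<Rightarrow> ('k::field, 'a::ab_group_add) gvs \<Rightarrow> ('a \<Rightarrow> 'a \<Rightarrow> 'a) \<Rightarrow> ('a \<Rightarrow> 'a) \<Rightarrow>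
     ('a \<Rightarrow> 'a \<Rightarrow> ('k, 'a) fsum) \<Rightarrow> bool" where
  "double_poisson_dg_algebra d A \<mu> \<delta> br \<longleftrightarrow>
     gcarrier A = UNIV \<and> dg_algebra A \<mu> \<delta> \<and> double_poisson_bracket d A \<mu> \<delta> br"

definition double_poisson_morphism ::
  "('k::field, 'a::ab_group_add) gvs \<Rightarrow> ('a \<Rightarrow> 'a \<Rightarrow> 'a) \<Rightarrow> ('a \<Rightarrow> 'a) \<Rightarrow>
     ('a \<Rightarrow> 'a \<Rightarrow> ('k, 'a) fsum) \<Rightarrow>
   ('k, 'b::ab_group_add) gvs \<Rightarrow> ('b \<Rightarrow> 'b \<Rightarrow> 'b) \<Rightarrow> ('b \<Rightarrow> 'b) \<Rightarrow>
     ('b \<Rightarrow> 'b \<Rightarrow> ('k, 'b) fsum) \<Rightarrow> ('a \<Rightarrow> 'b) \<Rightarrow> bool" where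
  "double_poisson_morphism A \<mu>A \<delta>A brA B \<mu>B \<delta>B brB \<phi> \<longleftrightarrow>
     gmap 0 A B \<phi> \<and>
     (\<forall>a b. \<phi> (\<mu>A a b) = \<mu>B (\<phi> a) (\<phi> b)) \<and>
     (\<forall>a. \<phi> (\<delta>A a) = \<delta>B (\<phi> a)) \<and>
     (\<forall>a b. teq B (tmap \<phi> (brA a b)) (brB (\<phi> a) (\<phi> b)))"


section \<open>$A_\infty$-algebras\<close>

text \<open>A family $(m_n)_{n \ge 1}$ is a function \<open>m :: nat \<Rightarrow> 'v list \<Rightarrow> 'v\<close>, where \<open>m n\<close> is only
  relevant for \<open>n \<ge> 1\<close> and on lists of length \<open>n\<close>. In the $A_\infty$-relations the operation
  $m_s$, of degree $2-s$, passes the first \<open>r\<close> arguments.\<close>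

definition a_infinity ::
  "('k::field, 'v::ab_group_add) gvs \<Rightarrow> (nat \<Rightarrow> 'v list \<Rightarrow> 'v) \<Rightarrow> bool" where
  "a_infinity E m \<longleftrightarrow>
     graded_space E \<and>
     (\<forall>n\<ge>1. multilinear n E E (m n) \<and> has_degree n (2 - int n) E E (m n)) \<and>
     (\<forall>n\<ge>1. \<forall>ds xs. length xs = n \<and> homog E ds xs \<longrightarrow>
        (\<Sum>(r, s, t) \<in> {(r, s, t). r + s + t = n \<and> s \<ge> 1}.
           sg (int (r + s * t)) (sg ((2 - int s) * sum_list (take r ds))
             (m (r + 1 + t) (take r xs @ [m s (take s (drop r xs))] @ drop (r + s) xs)))) = 0)"

definition fully_manageable ::
  "('k::field, 'v::ab_group_add) gvs \<Rightarrow> (nat \<Rightarrow> 'v list \<Rightarrow> 'v) \<Rightarrow> bool" where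
  "fully_manageable E m \<longleftrightarrow> dg_algebra E (\<lambda>x y. m 2 [x, y]) (\<lambda>x. m 1 [x])"

definition vanishes ::
  "('k, 'v::ab_group_add) gvs \<Rightarrow> (nat \<Rightarrow> 'v list \<Rightarrow> 'v) \<Rightarrow> nat \<Rightarrow> bool" where
  "vanishes E m n \<longleftrightarrow> (\<forall>xs. length xs = n \<and> set xs \<subseteq> gcarrier E \<longrightarrow> m n xs = 0)"

definition small :: "('k, 'v::ab_group_add) gvs \<Rightarrow> (nat \<Rightarrow> 'v list \<Rightarrow> 'v) \<Rightarrow> bool" where
  "small E m \<longleftrightarrow> (\<forall>n\<ge>4. vanishes E m n)"

definition essentially_odd :: "('k, 'v::ab_group_add) gvs \<Rightarrow> (nat \<Rightarrow> 'v list \<Rightarrow> 'v) \<Rightarrow> bool" where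
  "essentially_odd E m \<longleftrightarrow> (\<forall>i>1. vanishes E m (2 * i))"

definition strict_morphism ::
  "('k::field, 'v::ab_group_add) gvs \<Rightarrow> (nat \<Rightarrow> 'v list \<Rightarrow> 'v) \<Rightarrow>
   ('k, 'w::ab_group_add) gvs \<Rightarrow> (nat \<Rightarrow> 'w list \<Rightarrow> 'w) \<Rightarrow> ('v \<Rightarrow> 'w) \<Rightarrow> bool" where
  "strict_morphism E m E' m' f \<longleftrightarrow>
     gmap 0 E E' f \<and>
     (\<forall>n\<ge>1. \<forall>xs. length xs = n \<and> set xs \<subseteq> gcarrier E \<longrightarrow> f (m n xs) = m' n (map f xs))"

definition degenerate_cyclic ::
  "int \<Rightarrow> ('k::field, 'v::ab_group_add) gvs \<Rightarrow> (nat \<Rightarrow> 'v list \<Rightarrow> 'v) \<Rightarrow>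
     ('v \<Rightarrow> 'v \<Rightarrow> 'k) \<Rightarrow> bool" where
  "degenerate_cyclic e E m \<gamma> \<longleftrightarrow>
     graded_form e E \<gamma> \<and>
     (\<forall>p q. \<forall>x\<in>grade E p. \<forall>y\<in>grade E q. sg (p * q) (\<gamma> y x) = \<gamma> x y) \<and>
     (\<forall>n\<ge>1. \<forall>ds xs d0 x0. length xs = n \<and> homog E ds xs \<and> x0 \<in> grade E d0 \<longrightarrow>
        \<gamma> (m n xs) x0 = sg (int n + d0 * sum_list ds) (\<gamma> (m n (x0 # butlast xs)) (last xs)))"

definition cyclic_structure ::
  "int \<Rightarrow> ('k::field, 'v::ab_group_add) gvs \<Rightarrow> (nat \<Rightarrow> 'v list \<Rightarrow> 'v) \<Rightarrow>
     ('v \<Rightarrow> 'v \<Rightarrow> 'k) \<Rightarrow> bool" where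
  "cyclic_structure e E m \<gamma> \<longleftrightarrow>
     degenerate_cyclic e E m \<gamma> \<and>
     (\<forall>x\<in>gcarrier E. (\<forall>y\<in>gcarrier E. \<gamma> x y = 0) \<longrightarrow> x = 0)"

text \<open>Decompositions $E = E_0 \oplus E_1$ are those of a direct sum \<open>dsum V W\<close>.\<close>

definition summand ::
  "('k, 'v::ab_group_add \<times> 'w::ab_group_add) gvs \<Rightarrow> nat \<Rightarrow> ('v \<times> 'w) set" where
  "summand E i = {x \<in> gcarrier E. if i = 0 then snd x = 0 else fst x = 0}"

definition alternating :: "nat list \<Rightarrow> bool" where
  "alternating is \<longleftrightarrow> (\<forall>j. Suc j < length is \<longrightarrow> is ! j \<noteq> is ! Suc j)"

definition good_map ::
  "('k, 'v::ab_group_add \<times> 'w::ab_group_add) gvs \<Rightarrow> nat \<Rightarrow> (('v \<times> 'w) list \<Rightarrow> 'v \<times> 'w) \<Rightarrow> bool" where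
  "good_map E n f \<longleftrightarrow>
     (\<forall>is xs. length is = n \<and> set is \<subseteq> {0, 1} \<and> list_all2 (\<lambda>i x. x \<in> summand E i) is xs \<longrightarrow>
        (if alternating is then f xs \<in> summand E (hd is) else f xs = 0))"

definition good ::
  "('k, 'v::ab_group_add \<times> 'w::ab_group_add) gvs \<Rightarrow>
     (nat \<Rightarrow> ('v \<times> 'w) list \<Rightarrow> 'v \<times> 'w) \<Rightarrow> bool" where
  "good E m \<longleftrightarrow> essentially_odd E m \<and> (\<forall>n. odd n \<longrightarrow> good_map E n (m n))"

definition nice ::
  "('k, 'v::ab_group_add \<times> 'w::ab_group_add) gvs \<Rightarrow>
     (nat \<Rightarrow> ('v \<times> 'w) list \<Rightarrow> 'v \<times> 'w) \<Rightarrow> bool" where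
  "nice E m \<longleftrightarrow> good E m \<and> small E m"


section \<open>Duals and square-zero extensions\<close>

text \<open>\<open>dual\<close> is used for spaces filling their ambient type, where a linear functional is determined
  as a function.\<close>

definition dual :: "('k::field, 'v::ab_group_add) gvs \<Rightarrow> ('k, 'v \<Rightarrow> 'k) gvs" where
  "dual V = \<lparr>scl = (\<lambda>c f x. c * f x), grade = (\<lambda>n. {f. gmap n V ground f})\<rparr>"

definition dual_dif ::
  "('k::field, 'v::ab_group_add) gvs \<Rightarrow> ('v \<Rightarrow> 'v) \<Rightarrow> ('v \<Rightarrow> 'k) \<Rightarrow> 'v \<Rightarrow> 'k" where
  "dual_dif V \<delta> = hlin (dual V) (\<lambda>n f. - sg n (f \<circ> \<delta>))"

text \<open>A bimodule \<open>M\<close> over \<open>A\<close> is given by a left action \<open>l\<close> and a right action \<open>r\<close>. The two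
  one-sided actions on $M^{\#}$ are the cases $a \cdot f$ and $f \cdot b$ of
  $(a\cdot f\cdot b)(c) = (-1)^{|a|(|f|+|b|+|c|)} f(b\cdot c\cdot a)$, and those on $M[k]$ are the
  cases $a \cdot s^k m$ and $s^k m \cdot b$ of
  $a\cdot s^k m\cdot b = (-1)^{k|a|} s^k(a\cdot m\cdot b)$; in particular the right actions carry no
  sign.\<close>

definition dual_left ::
  "('k::field, 'a::ab_group_add) gvs \<Rightarrow> ('k, 'm::ab_group_add) gvs \<Rightarrow> ('m \<Rightarrow> 'a \<Rightarrow> 'm) \<Rightarrow>
     'a \<Rightarrow> ('m \<Rightarrow> 'k) \<Rightarrow> 'm \<Rightarrow> 'k" where
  "dual_left A M r a f =
     (\<lambda>c. hlin A (\<lambda>p a'. hlin (dual M) (\<lambda>q f'.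
            hlin M (\<lambda>n c'. sg (p * (q + n)) (f' (r c' a'))) c) f) a)"

definition dual_right :: "('a \<Rightarrow> 'm \<Rightarrow> 'm) \<Rightarrow> ('m \<Rightarrow> 'k) \<Rightarrow> 'a \<Rightarrow> 'm \<Rightarrow> 'k" where
  "dual_right l f b = (\<lambda>c. f (l b c))"

definition shift_left ::
  "int \<Rightarrow> ('k, 'a::ab_group_add) gvs \<Rightarrow> ('a \<Rightarrow> 'm \<Rightarrow> 'm::ab_group_add) \<Rightarrow> 'a \<Rightarrow> 'm \<Rightarrow> 'm" where
  "shift_left k A l a x = hlin A (\<lambda>p a'. sg (k * p) (l a' x)) a"

definition square_zero_mul ::
  "('a \<Rightarrow> 'a \<Rightarrow> 'a) \<Rightarrow> ('a \<Rightarrow> 'm \<Rightarrow> 'm) \<Rightarrow> ('m \<Rightarrow> 'a \<Rightarrow> 'm) \<Rightarrow> 'a \<times> 'm \<Rightarrow> 'a \<times> 'm::ab_group_add \<Rightarrow> 'a \<times> 'm"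
where
  "square_zero_mul \<mu> l r x y = (\<mu> (fst x) (fst y), r (snd x) (fst y) + l (fst x) (snd y))"

text \<open>$A \oplus M^{\#}[d-1]$ with its differential and its product. An element $(a, tf)$ is the pair
  \<open>(a, f)\<close>.\<close>

definition ext_space ::
  "int \<Rightarrow> ('k::field, 'a) gvs \<Rightarrow> ('k, 'm::ab_group_add) gvs \<Rightarrow> ('k, 'a \<times> ('m \<Rightarrow> 'k)) gvs" where
  "ext_space d A M = dsum A (shift (d - 1) (dual M))"

definition ext_dif ::
  "int \<Rightarrow> ('a \<Rightarrow> 'a) \<Rightarrow> ('k::field, 'm::ab_group_add) gvs \<Rightarrow> ('m \<Rightarrow> 'm) \<Rightarrow>
     'a \<times> ('m \<Rightarrow> 'k) \<Rightarrow> 'a \<times> ('m \<Rightarrow> 'k)" where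
  "ext_dif d \<delta>A M \<delta>M x = (\<delta>A (fst x), shift_dif (d - 1) (dual_dif M \<delta>M) (snd x))"

definition ext_mul ::
  "int \<Rightarrow> ('k::field, 'a::ab_group_add) gvs \<Rightarrow> ('a \<Rightarrow> 'a \<Rightarrow> 'a) \<Rightarrow> ('k, 'm::ab_group_add) gvs \<Rightarrow>
     ('a \<Rightarrow> 'm \<Rightarrow> 'm) \<Rightarrow> ('m \<Rightarrow> 'a \<Rightarrow> 'm) \<Rightarrow>
     'a \<times> ('m \<Rightarrow> 'k) \<Rightarrow> 'a \<times> ('m \<Rightarrow> 'k) \<Rightarrow> 'a \<times> ('m \<Rightarrow> 'k)" where
  "ext_mul d A \<mu>A M l r =
     square_zero_mul \<mu>A (shift_left (d - 1) A (dual_left A M r)) (dual_right l)"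

text \<open>The form $\gamma_\phi$; the form $\gamma_A$ is the case $\phi = \mathrm{id}_A$. Here
  $|tf| = |f| - d + 1$.\<close>

definition ext_form ::
  "int \<Rightarrow> ('k::field, 'a::ab_group_add) gvs \<Rightarrow> ('k, 'b::ab_group_add) gvs \<Rightarrow> ('a \<Rightarrow> 'b) \<Rightarrow>
     'a \<times> ('b \<Rightarrow> 'k) \<Rightarrow> 'a \<times> ('b \<Rightarrow> 'k) \<Rightarrow> 'k" where
  "ext_form d A B \<phi> x y =
     (snd x) (\<phi> (fst y)) +
     hlin A (\<lambda>p a. hlin (dual B) (\<lambda>q f. sg (p * (q - d + 1)) (f (\<phi> a))) (snd y)) (fst x)"

text \<open>\<open>m\<close> is the structure on $\partial_{d-1}A$ corresponding to the double Poisson bracket \<open>br\<close>.\<close>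

definition corresponding_structure ::
  "int \<Rightarrow> ('k::field, 'a::ab_group_add) gvs \<Rightarrow> ('a \<Rightarrow> 'a \<Rightarrow> 'a) \<Rightarrow> ('a \<Rightarrow> 'a) \<Rightarrow>
     ('a \<Rightarrow> 'a \<Rightarrow> ('k, 'a) fsum) \<Rightarrow>
     (nat \<Rightarrow> ('a \<times> ('a \<Rightarrow> 'k)) list \<Rightarrow> 'a \<times> ('a \<Rightarrow> 'k)) \<Rightarrow> bool" where
  "corresponding_structure d A \<mu> \<delta> br m \<longleftrightarrow>
    (let E = ext_space d A A; \<gamma> = ext_form d A A id in
     a_infinity E m \<and> nice E m \<and> cyclic_structure (d - 1) E m \<gamma> \<and>
     (\<forall>n\<ge>1. \<forall>xs. length xs = n \<and> set xs \<subseteq> summand E 0 \<longrightarrow> m n xs \<in> summand E 0) \<and>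
     (\<forall>x\<in>gcarrier E. m 1 [x] = ext_dif d \<delta> A \<delta> x) \<and>
     (\<forall>x\<in>gcarrier E. \<forall>y\<in>gcarrier E. m 2 [x, y] = ext_mul d A \<mu> A \<mu> \<mu> x y) \<and>
     (\<forall>p q r s. \<forall>a\<in>grade A p. \<forall>b\<in>grade A q. \<forall>f\<in>grade (dual A) r. \<forall>g\<in>grade (dual A) s.
        tpair A s f g (br a b) =
          sg (q * (p + s + 1)) (\<gamma> (m 3 [(b, 0), (0, g), (a, 0)]) (0, f))))"

text \<open>\<open>m3\<close> is a good map with the prescribed values. The values of \<open>mA 3\<close> and \<open>mB 3\<close> used here lie
  in $A$ and $B^{\#}[d-1]$ by goodness, and are viewed in $A \oplus B^{\#}[d-1]$.\<close>

definition is_m3_phi ::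
  "int \<Rightarrow> ('k::field, 'a::ab_group_add) gvs \<Rightarrow> ('k, 'b::ab_group_add) gvs \<Rightarrow> ('a \<Rightarrow> 'b) \<Rightarrow>
     (nat \<Rightarrow> ('a \<times> ('a \<Rightarrow> 'k)) list \<Rightarrow> 'a \<times> ('a \<Rightarrow> 'k)) \<Rightarrow>
     (nat \<Rightarrow> ('b \<times> ('b \<Rightarrow> 'k)) list \<Rightarrow> 'b \<times> ('b \<Rightarrow> 'k)) \<Rightarrow>
     (('a \<times> ('b \<Rightarrow> 'k)) list \<Rightarrow> 'a \<times> ('b \<Rightarrow> 'k)) \<Rightarrow> bool" where
  "is_m3_phi d A B \<phi> mA mB m3 \<longleftrightarrow>
     multilinear 3 (ext_space d A B) (ext_space d A B) m3 \<and>
     good_map (ext_space d A B) 3 m3 \<and>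
     (\<forall>p q r. \<forall>a\<in>grade A p. \<forall>b\<in>grade A q. \<forall>f\<in>grade (dual B) r.
        m3 [(a, 0), (0, f), (b, 0)] = (fst (mA 3 [(a, 0), (0, f \<circ> \<phi>), (b, 0)]), 0)) \<and>
     (\<forall>q r s. \<forall>b\<in>grade A q. \<forall>f\<in>grade (dual B) r. \<forall>g\<in>grade (dual B) s.
        m3 [(0, f), (b, 0), (0, g)] = (0, snd (mB 3 [(0, f), (\<phi> b, 0), (0, g)])))"

definition m_phi ::
  "int \<Rightarrow> ('k::field, 'a::ab_group_add) gvs \<Rightarrow> ('a \<Rightarrow> 'a \<Rightarrow> 'a) \<Rightarrow> ('a \<Rightarrow> 'a) \<Rightarrow>
   ('k, 'b::ab_group_add) gvs \<Rightarrow> ('b \<Rightarrow> 'b \<Rightarrow> 'b) \<Rightarrow> ('b \<Rightarrow> 'b) \<Rightarrow> ('a \<Rightarrow> 'b) \<Rightarrow>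
     (('a \<times> ('b \<Rightarrow> 'k)) list \<Rightarrow> 'a \<times> ('b \<Rightarrow> 'k)) \<Rightarrow>
     nat \<Rightarrow> ('a \<times> ('b \<Rightarrow> 'k)) list \<Rightarrow> 'a \<times> ('b \<Rightarrow> 'k)" where
  "m_phi d A \<mu>A \<delta>A B \<mu>B \<delta>B \<phi> m3 n xs =
     (if n = 1 then ext_dif d \<delta>A B \<delta>B (xs ! 0)
      else if n = 2 then
        ext_mul d A \<mu>A B (\<lambda>a b. \<mu>B (\<phi> a) b) (\<lambda>b a. \<mu>B b (\<phi> a)) (xs ! 0) (xs ! 1)
      else if n = 3 then m3 xs
      else 0)"

definition Phi_A :: "('a \<Rightarrow> 'b) \<Rightarrow> 'a \<times> ('b \<Rightarrow> 'k) \<Rightarrow> 'a \<times> ('a \<Rightarrow> 'k)" where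
  "Phi_A \<phi> x = (fst x, snd x \<circ> \<phi>)"

definition Phi_B :: "('a \<Rightarrow> 'b) \<Rightarrow> 'a \<times> ('b \<Rightarrow> 'k) \<Rightarrow> 'b \<times> ('b \<Rightarrow> 'k)" where
  "Phi_B \<phi> x = (\<phi> (fst x), snd x)"

end

theory Submission
  imports Defs
begin

text \<open>The maps \<open>Phi_A\<close> and \<open>Phi_B\<close> are jointly injective, so the $A_\infty$-relations on
  $\partial_{d-1}\phi$ follow from those on $\partial_{d-1}A$ and $\partial_{d-1}B$ as soon as both maps
  commute with all operations; cyclicity is likewise pulled back along \<open>Phi_A\<close>. Commutation with
  $m_1$ and $m_2$ is the compatibility of $\phi$ with differentials and products. For $m_3$ only two
  identities are not immediate, namely
  $m_3^B(\phi a, tf, \phi b) = \phi(m_3^A(a, t(f\phi), b))$ and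
  $m_3^A(t(f\phi), b, t(g\phi)) = m_3^B(tf, \phi b, tg)\circ\phi$. Pairing $m_3$ with
  functionals recovers the double bracket, and $\phi$ preserves brackets, so the forms
  $\gamma_A(m_3^A(a,t(f\phi),b),t(g\phi))$ and $\gamma_B(m_3^B(\phi a,tf,\phi b),tg)$ agree. The first
  identity follows because functionals separate points of $B$, the second by applying cyclicity to
  both sides.\<close>

text \<open>Neither map is injective alone: \<open>Phi_A\<close> forgets a functional off the image
  of \<open>\<phi>\<close>, and \<open>Phi_B\<close> forgets the kernel of \<open>\<phi>\<close>;
  but the first keeps the coordinate in A and the second the coordinate in the dual of B. The
  bookkeeping is dominated by Koszul signs, which are defined through homogeneous components. Two
  facts tame them. Maps of degree zero preserve components, so signed formulas are natural along
  \<open>\<phi>\<close> and along precomposition with \<open>\<phi>\<close>. A functional of degree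
  n sees only elements of degree -n, so in a pairing a sign that varies with the argument becomes a
  constant. One property does not follow from the relations: in arity three they give associativity
  of the product only up to terms in the unary and ternary operations, so strict associativity is
  computed from an explicit formula for the product. Separation of points of B is read off from the
  nondegeneracy of the form on the extension of B by its dual, without constructing
  functionals.\<close>

lemma sg_simps [simp]:
  "sg n 0 = 0" "fst (sg n p) = sg n (fst p)" "snd (sg n p) = sg n (snd p)"
  "sg n (f :: _ \<Rightarrow> _) x = sg n (f x)"
  by (auto simp: sg_def)

lemma sg_sg: "sg m (sg n x) = sg (m + n) x"
  by (auto simp: sg_def)

lemma sg_add: "sg n (x + y) = sg n x + sg n y"
  by (simp add: sg_def)

lemma sg_eq_iff [simp]: "sg n x = sg n y \<longleftrightarrow> x = y"
  by (simp add: sg_def)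

section \<open>Homogeneous components of graded spaces and naturality of signed formulas\<close>

lemma graded_spaceD:
  assumes "graded_space V"
  shows "vector_space (scl V)" "0 \<in> grade V n"
    "x \<in> grade V n \<Longrightarrow> y \<in> grade V n \<Longrightarrow> x + y \<in> grade V n"
    "x \<in> grade V n \<Longrightarrow> scl V c x \<in> grade V n"
    "x \<in> grade V n \<Longrightarrow> sg m x \<in> grade V n"
    "scl V c 0 = 0" "scl V c (x + y) = scl V c x + scl V c y"
proof -
  have vs: "vector_space (scl V)" and sub: "module.subspace (scl V) (grade V n)"
    using assms by (auto simp: graded_space_def)
  then have m: "module (scl V)"
    by (simp add: module_def vector_space_def)
  show "vector_space (scl V)" by fact
  show "0 \<in> grade V n" "x \<in> grade V n \<Longrightarrow> y \<in> grade V n \<Longrightarrow> x + y \<in> grade V n"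
    "x \<in> grade V n \<Longrightarrow> scl V c x \<in> grade V n"
    using sub by (auto simp: module.subspace_def[OF m])
  show "x \<in> grade V n \<Longrightarrow> sg m x \<in> grade V n"
    using module.subspace_neg[OF m sub] by (auto simp: sg_def)
  show "scl V c 0 = 0" "scl V c (x + y) = scl V c x + scl V c y"
    by (auto simp: module.scale_zero_right[OF m] module.scale_right_distrib[OF m])
qed

lemma is_decomp_unique:
  assumes "graded_space V" "is_decomp V x c"
  shows "part V n x = c n" "degs V x = {n. c n \<noteq> 0}"
proof -
  have "(THE c. is_decomp V x c) = c"
    using assms by (intro the_equality) (auto simp: graded_space_def)
  then show "part V n x = c n" "degs V x = {n. c n \<noteq> 0}"
    by (auto simp: part_def degs_def)
qed

text \<open>The defining sum runs over the support, which differs from element to element. A common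
  finite superset allows sums to be added and compared termwise.\<close>

lemma is_decomp_sum:
  assumes "is_decomp V x c" "finite I" "{n. c n \<noteq> 0} \<subseteq> I"
  shows "x = (\<Sum>n\<in>I. c n)"
proof -
  have "x = (\<Sum>n | c n \<noteq> 0. c n)" using assms(1) by (simp add: is_decomp_def)
  also have "\<dots> = (\<Sum>n\<in>I. c n)" using assms by (intro sum.mono_neutral_left) auto
  finally show ?thesis .
qed

lemma is_decompI:
  assumes "\<And>n. c n \<in> grade V n" "finite I" "{n. c n \<noteq> 0} \<subseteq> I" "x = (\<Sum>n\<in>I. c n)"
  shows "is_decomp V x c"
proof -
  have "(\<Sum>n\<in>I. c n) = (\<Sum>n | c n \<noteq> 0. c n)"
    using assms by (intro sum.mono_neutral_right) auto
  then show ?thesis using assms finite_subset[OF assms(3,2)] by (simp add: is_decomp_def)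
qed

lemma is_decomp_homogeneous:
  assumes "graded_space V" "x \<in> grade V n"
  shows "is_decomp V x (\<lambda>k. if k = n then x else 0)"
  using assms by (intro is_decompI[where I = "{n}"]) (auto simp: graded_spaceD)

text \<open>Zero lies in every grade and has no degrees at all, so \<open>F n 0 = 0\<close> is what
  makes both sides agree when x is zero.\<close>

lemma hlin_homogeneous:
  assumes "graded_space V" "x \<in> grade V n" "F n 0 = 0"
  shows "hlin V F x = F n x"
proof -
  note u = is_decomp_unique[OF assms(1) is_decomp_homogeneous[OF assms(1,2)]]
  show ?thesis
    using assms(3) u(2) by (cases "x = 0") (auto simp: hlin_def u(1))
qed

lemma hlin_decomp:
  assumes "graded_space V" "is_decomp V x c" "finite I" "{n. c n \<noteq> 0} \<subseteq> I" "\<And>n. F n 0 = 0"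
  shows "hlin V F x = (\<Sum>n\<in>I. F n (c n))"
proof -
  have "hlin V F x = (\<Sum>n | c n \<noteq> 0. F n (c n))"
    by (simp add: hlin_def is_decomp_unique[OF assms(1,2)])
  also have "\<dots> = (\<Sum>n\<in>I. F n (c n))"
    using assms by (intro sum.mono_neutral_left) auto
  finally show ?thesis .
qed

lemma hlin_zero [simp]: "graded_space V \<Longrightarrow> hlin V F 0 = 0"
  using is_decomp_unique(2)[of V 0 "\<lambda>_. 0"] by (simp add: hlin_def is_decomp_def graded_spaceD)

lemma grade_subset_gcarrier: "graded_space V \<Longrightarrow> x \<in> grade V n \<Longrightarrow> x \<in> gcarrier V"
  using is_decomp_homogeneous unfolding gcarrier_def by blast

lemma gcarrier_zero: "graded_space V \<Longrightarrow> 0 \<in> gcarrier V"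
  by (rule grade_subset_gcarrier[OF _ graded_spaceD(2)])

lemma gcarrier_add:
  assumes "graded_space V" "x \<in> gcarrier V" "y \<in> gcarrier V"
  shows "x + y \<in> gcarrier V"
proof -
  obtain c c' where c: "is_decomp V x c" "is_decomp V y c'"
    using assms by (auto simp: gcarrier_def)
  let ?I = "{n. c n \<noteq> 0} \<union> {n. c' n \<noteq> 0}"
  have fin: "finite ?I" using c by (simp add: is_decomp_def)
  have "is_decomp V (x + y) (\<lambda>n. c n + c' n)"
  proof (rule is_decompI[OF _ fin])
    show "x + y = (\<Sum>n\<in>?I. c n + c' n)"
      using is_decomp_sum[OF c(1) fin] is_decomp_sum[OF c(2) fin] by (simp add: sum.distrib)
  qed (use assms c in \<open>auto simp: is_decomp_def graded_spaceD\<close>)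
  then show ?thesis by (auto simp: gcarrier_def)
qed

text \<open>Peels off one homogeneous component at a time. The remainder is kept in the carrier
  because additivity of the maps in question is known only there.\<close>

lemma gcarrier_sum_induct [consumes 2, case_names zero add]:
  assumes "graded_space V" "x \<in> gcarrier V"
    and zero: "P 0"
    and add: "\<And>n x y. x \<in> grade V n \<Longrightarrow> y \<in> gcarrier V \<Longrightarrow> P y \<Longrightarrow> P (x + y)"
  shows "P x"
proof -
  obtain c where c: "is_decomp V x c" using assms by (auto simp: gcarrier_def)
  have "finite I \<Longrightarrow> (\<Sum>n\<in>I. c n) \<in> gcarrier V \<and> P (\<Sum>n\<in>I. c n)" for I
  proof (induction I rule: finite_induct)
    case empty
    show ?case using zero gcarrier_zero[OF assms(1)] by simp
  next
    case (insert n I)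
    have "c n \<in> grade V n" using c by (simp add: is_decomp_def)
    then show ?case
      using insert add gcarrier_add[OF assms(1)] grade_subset_gcarrier[OF assms(1)] by auto
  qed
  then show ?thesis using c unfolding is_decomp_def by metis
qed

lemma gcarrier_scl:
  assumes "graded_space V" "x \<in> gcarrier V"
  shows "scl V c x \<in> gcarrier V"
  using assms
proof (induction rule: gcarrier_sum_induct)
  case zero
  show ?case using assms by (simp add: graded_spaceD gcarrier_zero)
next
  case (add n x y)
  then show ?case
    using gcarrier_add[OF assms(1) grade_subset_gcarrier[OF assms(1)], of "scl V c x" n]
    by (simp add: graded_spaceD[OF assms(1)])
qed

lemma gmapD:
  assumes "gmap e V W f"
  shows "x \<in> gcarrier V \<Longrightarrow> y \<in> gcarrier V \<Longrightarrow> f (x + y) = f x + f y"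
    "x \<in> gcarrier V \<Longrightarrow> f (scl V c x) = scl W c (f x)"
    "x \<in> grade V n \<Longrightarrow> f x \<in> grade W (n + e)"
  using assms by (auto simp: gmap_def image_subset_iff)

lemma gmap_zero: "graded_space V \<Longrightarrow> gmap e V W f \<Longrightarrow> f 0 = 0"
  using gmapD(1)[of e V W f 0 0] gcarrier_zero[of V] by simp

lemma gmap_sum:
  assumes "graded_space V" "gmap e V W f" "finite I" "\<And>i. i \<in> I \<Longrightarrow> c i \<in> gcarrier V"
  shows "(\<Sum>i\<in>I. c i) \<in> gcarrier V \<and> f (\<Sum>i\<in>I. c i) = (\<Sum>i\<in>I. f (c i))"
  using assms(3,4)
  by (induction I rule: finite_induct)
    (simp_all add: gmap_zero[OF assms(1,2)] gcarrier_zero[OF assms(1)] gcarrier_add[OF assms(1)]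
      gmapD(1)[OF assms(2)])

text \<open>A map of degree zero sends components to components of the same degree. Some may be
  killed, so the sum for the image is taken over the support of c, which can be larger than that of
  the image.\<close>

lemma gmap_is_decomp:
  assumes V: "graded_space V" and f: "gmap 0 V W f" and c: "is_decomp V x c"
  shows "is_decomp W (f x) (f \<circ> c)"
proof (rule is_decompI)
  let ?I = "{n. c n \<noteq> 0}"
  have cg: "c n \<in> grade V n" for n using c by (simp add: is_decomp_def)
  show "(f \<circ> c) n \<in> grade W n" for n using gmapD(3)[OF f cg] by simp
  show fin: "finite ?I" using c by (simp add: is_decomp_def)
  show "{n. (f \<circ> c) n \<noteq> 0} \<subseteq> ?I" using gmap_zero[OF V f] by auto
  show "f x = (\<Sum>n\<in>?I. (f \<circ> c) n)"
    using gmap_sum[OF V f fin, of c] grade_subset_gcarrier[OF V cg] c by (simp add: is_decomp_def)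
qed

lemma gmap_gcarrier: "graded_space V \<Longrightarrow> gmap 0 V W f \<Longrightarrow> x \<in> gcarrier V \<Longrightarrow> f x \<in> gcarrier W"
  using gmap_is_decomp unfolding gcarrier_def by blast

text \<open>Since h preserves degrees, the sign attached to a component is the same before and after
  applying h. This naturality carries the signed formulas for differentials, actions and forms
  between A and B. Vanishing of F at zero accounts for the components that h kills.\<close>

lemma hlin_gmap:
  assumes "graded_space V" "graded_space W" "gmap 0 V W h" "x \<in> gcarrier V" "\<And>n. F n 0 = 0"
  shows "hlin W F (h x) = hlin V (\<lambda>n y. F n (h y)) x"
proof -
  obtain c where c: "is_decomp V x c" using assms by (auto simp: gcarrier_def)
  have h0: "h 0 = 0" using gmap_zero[OF assms(1,3)] .
  have fin: "finite {n. c n \<noteq> 0}" using c by (simp add: is_decomp_def)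
  have "{n. (h \<circ> c) n \<noteq> 0} \<subseteq> {n. c n \<noteq> 0}" using h0 by auto
  from hlin_decomp[where F = F, OF assms(2) gmap_is_decomp[OF assms(1,3) c] fin this assms(5)]
  have "hlin W F (h x) = (\<Sum>n | c n \<noteq> 0. F n (h (c n)))" by simp
  also have "\<dots> = hlin V (\<lambda>n y. F n (h y)) x"
    using hlin_decomp[OF assms(1) c fin, of "\<lambda>n y. F n (h y)"] h0 assms(5) by simp
  finally show ?thesis .
qed

lemma hlin_cong:
  assumes "graded_space V" "x \<in> gcarrier V" "\<And>n y. y \<in> grade V n \<Longrightarrow> F n y = G n y"
  shows "hlin V F x = hlin V G x"
proof -
  obtain c where c: "is_decomp V x c" using assms(2) by (auto simp: gcarrier_def)
  then have "part V n x \<in> grade V n" for n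
    using is_decomp_unique[OF assms(1) c] by (simp add: is_decomp_def)
  then show ?thesis using assms(3) by (simp add: hlin_def)
qed

lemma hlin_eq_zero: "(\<And>n y. y \<in> grade V n \<Longrightarrow> F n y = 0) \<Longrightarrow> graded_space V \<Longrightarrow> x \<in> gcarrier V \<Longrightarrow> hlin V F x = 0"
  using hlin_cong[of V x F "\<lambda>_ _. 0"] by (simp add: hlin_def)

text \<open>When the formula ignores the degree, summing over components only reassembles x. It is
  applied after \<open>hlin_cong\<close> has replaced a varying sign by a constant one.\<close>

lemma hlin_additive:
  assumes "graded_space V" "x \<in> gcarrier V"
    and add: "\<And>x y. x \<in> gcarrier V \<Longrightarrow> y \<in> gcarrier V \<Longrightarrow> G (x + y) = G x + G y"
  shows "hlin V (\<lambda>_. G) x = (G x :: 'w::ab_group_add)"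
proof -
  obtain c where c: "is_decomp V x c" using assms(2) by (auto simp: gcarrier_def)
  have cg: "c n \<in> gcarrier V" for n
    using c by (auto simp: is_decomp_def intro: grade_subset_gcarrier[OF assms(1)])
  have G0: "G 0 = 0" using add[OF gcarrier_zero gcarrier_zero] assms(1) by simp
  have "finite I \<Longrightarrow> (\<Sum>n\<in>I. c n) \<in> gcarrier V \<and> G (\<Sum>n\<in>I. c n) = (\<Sum>n\<in>I. G (c n))" for I
    by (induction I rule: finite_induct)
      (simp_all add: G0 gcarrier_zero[OF assms(1)] add cg gcarrier_add[OF assms(1)])
  then have "G x = (\<Sum>n | c n \<noteq> 0. G (c n))"
    using c by (metis is_decomp_def)
  then show ?thesis by (simp add: hlin_def is_decomp_unique[OF assms(1) c])
qed

lemma sum_apply: "(\<Sum>i\<in>I. F i) x = (\<Sum>i\<in>I. F i x)"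
  by (induction I rule: infinite_finite_induct) simp_all

lemma hlin_apply: "hlin V F x y = hlin V (\<lambda>n z. F n z y) x"
  by (simp add: hlin_def sum_apply)

section \<open>Direct sums, shifts and graded duals\<close>

lemma is_decomp_dsum:
  "is_decomp (dsum V W) x c \<longleftrightarrow> is_decomp V (fst x) (fst \<circ> c) \<and> is_decomp W (snd x) (snd \<circ> c)"
  (is "?l \<longleftrightarrow> ?r")
proof -
  \<comment> \<open>The two coordinates may have different supports; their union \<open>?J\<close>
    is the support of the pair and serves as common index set.\<close>
  let ?I = "{n. c n \<noteq> 0}" and ?J = "{n. (fst \<circ> c) n \<noteq> 0} \<union> {n. (snd \<circ> c) n \<noteq> 0}"
  have IJ: "?I = ?J" by (auto simp: prod_eq_iff)
  show ?thesis
  proof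
    assume l: ?l
    then have fin: "finite ?I" by (simp add: is_decomp_def)
    have "x = (\<Sum>n\<in>?I. c n)" using l by (simp add: is_decomp_def)
    then have "fst x = (\<Sum>n\<in>?I. (fst \<circ> c) n)" "snd x = (\<Sum>n\<in>?I. (snd \<circ> c) n)"
      by (simp_all add: fst_sum snd_sum)
    then show ?r
      using l fin IJ
      by (intro conjI is_decompI[where I = ?I]) (auto simp: is_decomp_def dsum_def mem_Times_iff)
  next
    assume r: ?r
    then have fin: "finite ?J" by (simp add: is_decomp_def)
    have "fst x = (\<Sum>n\<in>?J. (fst \<circ> c) n)" "snd x = (\<Sum>n\<in>?J. (snd \<circ> c) n)"
      using r fin is_decomp_sum[of V "fst x" "fst \<circ> c" ?J] is_decomp_sum[of W "snd x" "snd \<circ> c" ?J]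
      by auto
    then have "x = (\<Sum>n\<in>?J. c n)" by (simp add: prod_eq_iff fst_sum snd_sum)
    then show ?l
      using r fin IJ
      by (intro is_decompI[where I = ?J]) (auto simp: is_decomp_def dsum_def mem_Times_iff)
  qed
qed

lemma gcarrier_dsum: "gcarrier (dsum V W) = gcarrier V \<times> gcarrier W"
proof (intro set_eqI iffI)
  fix x assume "x \<in> gcarrier (dsum V W)"
  then show "x \<in> gcarrier V \<times> gcarrier W"
    by (auto simp: gcarrier_def is_decomp_dsum mem_Times_iff)
next
  fix x assume "x \<in> gcarrier V \<times> gcarrier W"
  then obtain c c' where "is_decomp V (fst x) c" "is_decomp W (snd x) c'"
    by (auto simp: gcarrier_def)
  then have "is_decomp (dsum V W) x (\<lambda>n. (c n, c' n))"
    by (simp add: is_decomp_dsum o_def)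
  then show "x \<in> gcarrier (dsum V W)" by (auto simp: gcarrier_def)
qed

lemma graded_space_dsum:
  assumes V: "graded_space V" and W: "graded_space W"
  shows "graded_space (dsum V W)"
proof -
  interpret V: vector_space "scl V" using V by (rule graded_spaceD)
  interpret W: vector_space "scl W" using W by (rule graded_spaceD)
  have scl: "scl (dsum V W) = (\<lambda>c (x, y). (scl V c x, scl W c y))"
    and gr: "grade (dsum V W) n = grade V n \<times> grade W n" for n
    by (simp_all add: dsum_def)
  have vs: "vector_space (scl (dsum V W))"
    unfolding scl
    by unfold_locales
      (auto simp: V.scale_right_distrib W.scale_right_distrib V.scale_left_distrib
        W.scale_left_distrib)
  have "module.subspace (scl (dsum V W)) (grade (dsum V W) n)" for n
    using vs V W
    by (auto simp: module.subspace_def vector_space_def module_def scl gr graded_spaceD zero_prod_def)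
  moreover have "c = c'" if "is_decomp (dsum V W) x c" "is_decomp (dsum V W) x c'" for x c c'
  proof -
    have "fst \<circ> c = fst \<circ> c'" "snd \<circ> c = snd \<circ> c'"
      using that V W unfolding is_decomp_dsum graded_space_def by blast+
    then show ?thesis by (metis ext comp_apply prod_eqI)
  qed
  ultimately show ?thesis using vs by (auto simp: graded_space_def)
qed

lemma is_decomp_shift:
  "is_decomp (shift m V) x (\<lambda>n. c (n + m)) \<longleftrightarrow> is_decomp V x c"
proof -
  have img: "{n. c n \<noteq> 0} = (\<lambda>n. n + m) ` {n. c (n + m) \<noteq> 0}"
    by (auto simp: image_iff intro!: exI[of _ "_ - m"])
  have gr: "(\<forall>n. c (n + m) \<in> grade (shift m V) n) \<longleftrightarrow> (\<forall>n. c n \<in> grade V n)"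
    by (simp add: shift_def) (metis diff_add_cancel)
  have "(\<Sum>n | c n \<noteq> 0. c n) = (\<Sum>n | c (n + m) \<noteq> 0. c (n + m))"
    by (subst img, subst sum.reindex) (auto simp: inj_on_def)
  moreover have "finite {n. c n \<noteq> 0} \<longleftrightarrow> finite {n. c (n + m) \<noteq> 0}"
    by (subst img, subst finite_image_iff) (auto simp: inj_on_def)
  ultimately show ?thesis unfolding is_decomp_def gr by simp
qed

lemma is_decomp_shift': "is_decomp (shift m V) x c \<longleftrightarrow> is_decomp V x (\<lambda>n. c (n - m))"
  using is_decomp_shift[of m V x "\<lambda>n. c (n - m)"] by simp

lemma gcarrier_shift: "gcarrier (shift m V) = gcarrier V"
  unfolding gcarrier_def using is_decomp_shift[of m V] is_decomp_shift'[of m V] by blast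

lemma graded_space_shift:
  assumes "graded_space V"
  shows "graded_space (shift m V)"
proof -
  have "c = c'" if "is_decomp (shift m V) x c" "is_decomp (shift m V) x c'" for x c c'
  proof
    fix n
    have "(\<lambda>n. c (n - m)) = (\<lambda>n. c' (n - m))"
      using assms that unfolding graded_space_def is_decomp_shift' by blast
    from fun_cong[OF this, of "n + m"] show "c n = c' n" by simp
  qed
  then show ?thesis using assms by (auto simp: graded_space_def shift_def)
qed

lemma vector_space_dual: "vector_space (scl (dual V))"
  by unfold_locales (auto simp: dual_def fun_eq_iff algebra_simps)

lemma grade_dual: "f \<in> grade (dual V) n \<longleftrightarrow> gmap n V ground f"
  by (simp add: dual_def)

text \<open>The ground field is concentrated in degree zero, so a functional of degree n can be
  nonzero only on degree -n. All later simplifications of pairing signs rest on this.\<close>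

lemma dual_grade_vanishes:
  assumes "f \<in> grade (dual V) n" "x \<in> grade V m" "m + n \<noteq> 0"
  shows "f x = 0"
  using gmapD(3)[OF assms(1)[unfolded grade_dual] assms(2)] assms(3) by (simp add: ground_def)

text \<open>For uniqueness of decompositions: on the elements of degree k only the component of
  degree -k can be nonzero, so it agrees there with f. The components are thus determined on
  homogeneous elements, hence everywhere by additivity.\<close>

lemma graded_space_dual:
  fixes V :: "('k::field, 'v::ab_group_add) gvs"
  assumes V: "graded_space V" "gcarrier V = UNIV"
  shows "graded_space (dual V)"
  unfolding graded_space_def
proof (intro conjI allI impI)
  show "vector_space (scl (dual V))" by (rule vector_space_dual)
  then have m: "module (scl (dual V))" by (simp add: module_def vector_space_def)
  show "module.subspace (scl (dual V)) (grade (dual V) n)" for n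
    unfolding module.subspace_def[OF m] grade_dual
    using V by (auto simp: gmap_def dual_def ground_def algebra_simps image_subset_iff
        split: if_splits) (metis add.right_neutral)
  fix f c c' assume c: "is_decomp (dual V) f c \<and> is_decomp (dual V) f c'"
  have eval: "c n x = (if n = - k then f x else 0)"
    if "is_decomp (dual V) f c" "x \<in> grade V k" for c n k x
  proof -
    have cg: "c n \<in> grade (dual V) n" for n using that by (simp add: is_decomp_def)
    have van: "c n x = 0" if "n \<noteq> - k" for n
      using dual_grade_vanishes[OF cg \<open>x \<in> grade V k\<close>, of n] that by simp
    \<comment> \<open>The index -k is inserted because the component there may be zero and then be
      missing from the support.\<close>
    have "f = (\<Sum>n\<in>insert (- k) {n. c n \<noteq> 0}. c n)"
      using that by (intro is_decomp_sum) (auto simp: is_decomp_def)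
    then have "f x = (\<Sum>n\<in>insert (- k) {n. c n \<noteq> 0}. c n x)"
      by (metis sum_apply)
    also have "\<dots> = (\<Sum>n\<in>{- k}. c n x)"
      using that van by (intro sum.mono_neutral_right) (auto simp: is_decomp_def)
    finally show ?thesis using van by simp
  qed
  show "c = c'"
  proof (intro ext)
    fix n x
    have g: "gmap n V ground (c n)" "gmap n V ground (c' n)"
      using c by (auto simp: is_decomp_def dual_def)
    show "c n x = c' n x"
      using V(1) UNIV_I[of x, folded V(2)]
    proof (induction rule: gcarrier_sum_induct)
      case zero
      then show ?case using gmap_zero[OF V(1) g(1)] gmap_zero[OF V(1) g(2)] by simp
    next
      case (add k x y)
      have "c n x = c' n x" using eval[of c x k n] eval[of c' x k n] c add by simp
      then show ?case using add gmapD(1)[OF g(1)] gmapD(1)[OF g(2)] V(2) by simp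
    qed
  qed
qed

section \<open>Multilinear maps\<close>

text \<open>Sums alone are enough: each grade is closed under scalars, so homogeneous generators
  already contain their multiples, and additivity suffices to compare maps.\<close>

inductive_set addspan :: "'v::ab_group_add set \<Rightarrow> 'v set" for S where
  zero: "0 \<in> addspan S"
| base: "s \<in> S \<Longrightarrow> s \<in> addspan S"
| add: "x \<in> addspan S \<Longrightarrow> y \<in> addspan S \<Longrightarrow> x + y \<in> addspan S"

definition multiadditive ::
  "nat \<Rightarrow> 'v::ab_group_add set \<Rightarrow> ('v list \<Rightarrow> 'w::ab_group_add) \<Rightarrow> bool" where
  "multiadditive n C f \<longleftrightarrow>
     (\<forall>xs. length xs = n \<and> set xs \<subseteq> C \<longrightarrow>
        (\<forall>i<n. \<forall>y\<in>C. f (xs[i := xs ! i + y]) = f xs + f (xs[i := y])))"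

lemma multiadditiveD:
  assumes "multiadditive n C f" "length xs = n" "set xs \<subseteq> C" "i < n" "x \<in> C" "y \<in> C"
  shows "f (xs[i := x + y]) = f (xs[i := x]) + f (xs[i := y])"
proof -
  have "length (xs[i := x]) = n" "set (xs[i := x]) \<subseteq> C"
    using assms by (auto dest: set_update_subset_insert[THEN subsetD])
  with assms show ?thesis unfolding multiadditive_def by (metis list_update_overwrite nth_list_update_eq)
qed

lemma multiadditive_zero:
  assumes "multiadditive n C f" "0 \<in> C" "length xs = n" "set xs \<subseteq> C" "i < n" "xs ! i = 0"
  shows "f xs = 0"
  using multiadditiveD[OF assms(1,3,4,5) assms(2) assms(2)] assms(6)
  by (metis add_0 add_cancel_left_left list_update_id)

text \<open>The slots are freed one at a time: k counts the leading slots that may hold arbitrary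
  elements while all later ones hold generators. To free one more slot, its entry is written as a
  sum of generators.\<close>

lemma multiadditive_ext:
  assumes f: "multiadditive n C f" and g: "multiadditive n C g" and C: "C = addspan S"
    and eq: "\<And>xs. length xs = n \<Longrightarrow> set xs \<subseteq> S \<Longrightarrow> f xs = g xs"
    and xs: "length xs = n" "set xs \<subseteq> C"
  shows "f xs = g xs"
proof -
  have "f xs = g xs" if "length xs = n" "set xs \<subseteq> C" "\<And>i. k \<le> i \<Longrightarrow> i < n \<Longrightarrow> xs ! i \<in> S"
    for k xs
    using that
  proof (induction k arbitrary: xs)
    case 0
    then show ?case by (intro eq) (auto simp: in_set_conv_nth)
  next
    case (Suc k)
    show ?case
    proof (cases "k < n")
      case False
      then show ?thesis using Suc by auto
    next
      case k: True
      have upd: "set (xs[k := x]) \<subseteq> C" if "x \<in> C" for x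
        using Suc.prems that by (auto dest: set_update_subset_insert[THEN subsetD])
      have "f (xs[k := x]) = g (xs[k := x])" if "x \<in> addspan S" for x
        using that
      proof induction
        case zero
        have "0 \<in> C" by (simp add: C addspan.zero)
        then show ?case
          using multiadditive_zero[OF f, of "xs[k := 0]" k] multiadditive_zero[OF g, of "xs[k := 0]" k]
            upd[of 0] Suc.prems(1) k by simp
      next
        case (base s)
        then have "s \<in> C" by (simp add: C addspan.base)
        then show ?case
          using Suc.prems base upd[of s] k
          by (intro Suc.IH) (auto simp: nth_list_update)
      next
        case (add x y)
        then show ?case
          using multiadditiveD[OF f Suc.prems(1,2) k, of x y] multiadditiveD[OF g Suc.prems(1,2) k, of x y]
          by (simp add: C)
      qed
      moreover have "xs ! k \<in> addspan S" using Suc.prems k by (auto simp: C)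
      ultimately show ?thesis by (metis list_update_id)
    qed
  qed
  from this[of xs n] show ?thesis using xs by simp
qed

lemma multilinear_multiadditive: "multilinear n V W f \<Longrightarrow> multiadditive n (gcarrier V) f"
  by (simp add: multilinear_def multiadditive_def)

lemma multiadditive_comp_left:
  assumes "multiadditive n C f" "\<And>x y. h (x + y) = h x + h y"
  shows "multiadditive n C (\<lambda>xs. h (f xs))"
  using assms by (simp add: multiadditive_def)

lemma multiadditive_comp_right:
  fixes h :: "'v::ab_group_add \<Rightarrow> 'u::ab_group_add"
  assumes "multiadditive n D f" "\<And>x y. h (x + y) = h x + h y" "h ` C \<subseteq> D"
  shows "multiadditive n C (\<lambda>xs. f (map h xs))"
  unfolding multiadditive_def
proof (intro allI impI ballI)
  fix xs :: "'v list" and i y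
  assume xs: "length xs = n \<and> set xs \<subseteq> C" "i < n" "y \<in> C"
  then have "xs ! i \<in> C" using nth_mem[of i xs] by blast
  then have "map h xs ! i = h (xs ! i)" "h (xs ! i) \<in> D" "h y \<in> D" "set (map h xs) \<subseteq> D"
    using assms(3) xs by auto
  then show "f (map h (xs[i := xs ! i + y])) = f (map h xs) + f (map h (xs[i := y]))"
    using multiadditiveD[OF assms(1), of "map h xs" i "h (xs ! i)" "h y"] xs
    by (metis assms(2) length_map list_update_id map_update)
qed

lemma multilinearD:
  assumes "multilinear n V W f" "length xs = n" "set xs \<subseteq> gcarrier V"
  shows "f xs \<in> gcarrier W"
    "i < n \<Longrightarrow> y \<in> gcarrier V \<Longrightarrow> f (xs[i := xs ! i + y]) = f xs + f (xs[i := y])"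
    "i < n \<Longrightarrow> f (xs[i := scl V c (xs ! i)]) = scl W c (f xs)"
  using assms by (auto simp: multilinear_def)

lemma homog_gcarrier: "graded_space V \<Longrightarrow> homog V ds xs \<Longrightarrow> set xs \<subseteq> gcarrier V"
  using grade_subset_gcarrier
  by (fastforce simp: homog_def list_all2_conv_all_nth in_set_conv_nth)

lemma homog_map: "gmap 0 V W h \<Longrightarrow> homog V ds xs \<Longrightarrow> homog W ds (map h xs)"
  using gmapD(3) by (fastforce simp: homog_def list_all2_conv_all_nth)

lemma list2_set_subset: "length xs = 2 \<Longrightarrow> set xs \<subseteq> C \<Longrightarrow> \<exists>x y. xs = [x, y] \<and> x \<in> C \<and> y \<in> C"
  by (auto simp: numeral_2_eq_2 length_Suc_conv)

section \<open>Pulling back structures\<close>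

lemma a_infinityD:
  assumes "a_infinity E m"
  shows "graded_space E" "n \<ge> 1 \<Longrightarrow> multilinear n E E (m n)"
    "n \<ge> 1 \<Longrightarrow> has_degree n (2 - int n) E E (m n)"
  using assms by (auto simp: a_infinity_def)

lemma strict_morphismD:
  assumes "strict_morphism E m E' m' f"
  shows "gmap 0 E E' f"
    "n \<ge> 1 \<Longrightarrow> length xs = n \<Longrightarrow> set xs \<subseteq> gcarrier E \<Longrightarrow> f (m n xs) = m' n (map f xs)"
  using assms by (auto simp: strict_morphism_def)

text \<open>One summand of the relations. The degrees \<open>ds\<close> are a separate argument
  because a map of degree zero changes the entries but not their degrees, so both sides of a
  comparison carry the same signs.\<close>

definition stasheff_term ::
  "int list \<Rightarrow> (nat \<Rightarrow> 'v list \<Rightarrow> 'v) \<Rightarrow> 'v list \<Rightarrow> nat \<times> nat \<times> nat \<Rightarrow> 'v::ab_group_add" where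
  "stasheff_term ds m xs = (\<lambda>(r, s, t). sg (int (r + s * t)) (sg ((2 - int s) * sum_list (take r ds))
     (m (r + 1 + t) (take r xs @ [m s (take s (drop r xs))] @ drop (r + s) xs))))"

lemma a_infinity_stasheff:
  assumes "a_infinity E m" "n \<ge> 1" "length xs = n" "homog E ds xs"
  shows "(\<Sum>p\<in>{(r, s, t). r + s + t = n \<and> s \<ge> 1}. stasheff_term ds m xs p) = 0"
  using assms unfolding a_infinity_def stasheff_term_def by blast

text \<open>In each summand h passes through the outer operation and then the inner one, while the
  signs depend on \<open>ds\<close> only. Strictness is available on the carrier, so the value of
  the inner operation has to lie there; this is the closure assumption on m.\<close>

lemma strict_morphism_stasheff_sum:
  assumes m: "\<And>n xs. n \<ge> 1 \<Longrightarrow> length xs = n \<Longrightarrow> set xs \<subseteq> gcarrier E \<Longrightarrow> m n xs \<in> gcarrier E"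
    and h: "strict_morphism E m E' m' h" and add: "\<And>x y. h (x + y) = h x + h y"
    and xs: "length xs = n" "set xs \<subseteq> gcarrier E"
  shows "h (\<Sum>p\<in>{(r, s, t). r + s + t = n \<and> s \<ge> 1}. stasheff_term ds m xs p) =
    (\<Sum>p\<in>{(r, s, t). r + s + t = n \<and> s \<ge> 1}. stasheff_term ds m' (map h xs) p)"
proof -
  let ?I = "{(r, s, t). r + s + t = n \<and> s \<ge> 1}"
  have h0: "h 0 = 0" using add[of 0 0] by simp
  have "h (stasheff_term ds m xs p) = stasheff_term ds m' (map h xs) p" if p: "p \<in> ?I" for p
  proof -
    obtain r s t where rst: "p = (r, s, t)" "r + s + t = n" "s \<ge> 1" using p by auto
    have sub: "set (take s (drop r xs)) \<subseteq> gcarrier E" "set (take r xs) \<subseteq> gcarrier E"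
      "set (drop (r + s) xs) \<subseteq> gcarrier E"
      using xs(2) by (auto dest: in_set_takeD in_set_dropD)
    then have "m s (take s (drop r xs)) \<in> gcarrier E"
      using rst xs by (intro m) auto
    moreover have "h (sg k x) = sg k (h x)" for k x
      using add[of x "- x"] h0 by (simp add: sg_def eq_neg_iff_add_eq_0 add.commute)
    ultimately show ?thesis
      using sub rst xs
      by (simp add: stasheff_term_def strict_morphismD(2)[OF h] take_map drop_map)
  qed
  then have "(\<Sum>p\<in>?I. h (stasheff_term ds m xs p)) = (\<Sum>p\<in>?I. stasheff_term ds m' (map h xs) p)"
    by (rule sum.cong[OF refl])
  then show ?thesis
    using sum_comp_morphism[of h "stasheff_term ds m xs" ?I] h0 add by (simp add: o_def)
qed

text \<open>E behaves like a subspace of the direct sum of E1 and E2. Injectivity transfers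
  equations; reflection of carriers and grades transfers closure under the operations and their
  degrees.\<close>

locale jointly_embedded =
  fixes E :: "('k::field, 'v::ab_group_add) gvs"
    and E1 :: "('k, 'w::ab_group_add) gvs" and E2 :: "('k, 'u::ab_group_add) gvs"
    and m :: "nat \<Rightarrow> 'v list \<Rightarrow> 'v" and m1 :: "nat \<Rightarrow> 'w list \<Rightarrow> 'w" and m2 :: "nat \<Rightarrow> 'u list \<Rightarrow> 'u"
    and F :: "'v \<Rightarrow> 'w" and G :: "'v \<Rightarrow> 'u"
  assumes E: "graded_space E"
    and F: "strict_morphism E m E1 m1 F" and G: "strict_morphism E m E2 m2 G"
    and F_add: "F (x + y) = F x + F y" and G_add: "G (x + y) = G x + G y"
    and inj: "F x = F y \<Longrightarrow> G x = G y \<Longrightarrow> x = y"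
    and reflects_gcarrier: "F x \<in> gcarrier E1 \<Longrightarrow> G x \<in> gcarrier E2 \<Longrightarrow> x \<in> gcarrier E"
    and reflects_grade: "F x \<in> grade E1 k \<Longrightarrow> G x \<in> grade E2 k \<Longrightarrow> x \<in> grade E k"
    and a_inf1: "a_infinity E1 m1" and a_inf2: "a_infinity E2 m2"
begin

lemmas F_gmap = strict_morphismD(1)[OF F] and G_gmap = strict_morphismD(1)[OF G]

lemma gcarrier_map:
  assumes "set xs \<subseteq> gcarrier E"
  shows "set (map F xs) \<subseteq> gcarrier E1" "set (map G xs) \<subseteq> gcarrier E2"
  using assms gmap_gcarrier[OF E F_gmap] gmap_gcarrier[OF E G_gmap] by auto

lemma m_gcarrier:
  assumes "n \<ge> 1" "length xs = n" "set xs \<subseteq> gcarrier E"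
  shows "m n xs \<in> gcarrier E"
  using assms multilinearD(1)[OF a_infinityD(2)[OF a_inf1], of n "map F xs"]
    multilinearD(1)[OF a_infinityD(2)[OF a_inf2], of n "map G xs"] gcarrier_map[OF assms(3)]
  by (intro reflects_gcarrier) (auto simp: strict_morphismD(2)[OF F] strict_morphismD(2)[OF G])

lemma m_multilinear:
  assumes n: "n \<ge> 1"
  shows "multilinear n E E (m n)"
  unfolding multilinear_def
proof (intro allI impI conjI ballI)
  fix xs assume xs: "length xs = n \<and> set xs \<subseteq> gcarrier E"
  show mem: "m n xs \<in> gcarrier E" using m_gcarrier[OF n] xs by blast
  fix i assume i: "i < n"
  have xi: "xs ! i \<in> gcarrier E" using xs i by auto
  have upd: "set (xs[i := y]) \<subseteq> gcarrier E" if "y \<in> gcarrier E" for y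
    using xs that by (auto dest: set_update_subset_insert[THEN subsetD])
  note M1 = multilinearD[OF a_infinityD(2)[OF a_inf1 n], of "map F xs"]
  note M2 = multilinearD[OF a_infinityD(2)[OF a_inf2 n], of "map G xs"]
  note strict = strict_morphismD(2)[OF F n] strict_morphismD(2)[OF G n]
  note gc = gcarrier_map[OF conjunct2[OF xs]]
  {
    fix y assume y: "y \<in> gcarrier E"
    have y': "xs ! i + y \<in> gcarrier E" by (rule gcarrier_add[OF E xi y])
    show "m n (xs[i := xs ! i + y]) = m n xs + m n (xs[i := y])"
    proof (rule inj)
      show "F (m n (xs[i := xs ! i + y])) = F (m n xs + m n (xs[i := y]))"
        using M1(2)[of i "F y"] xs i gc gmap_gcarrier[OF E F_gmap y]
        by (simp add: strict upd[OF y] upd[OF y'] F_add map_update)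
      show "G (m n (xs[i := xs ! i + y])) = G (m n xs + m n (xs[i := y]))"
        using M2(2)[of i "G y"] xs i gc gmap_gcarrier[OF E G_gmap y]
        by (simp add: strict upd[OF y] upd[OF y'] G_add map_update)
    qed
  }
  fix c
  have y': "scl E c (xs ! i) \<in> gcarrier E" by (rule gcarrier_scl[OF E xi])
  show "m n (xs[i := scl E c (xs ! i)]) = scl E c (m n xs)"
  proof (rule inj)
    show "F (m n (xs[i := scl E c (xs ! i)])) = F (scl E c (m n xs))"
      using M1(3)[of i c] xs i gc
      by (simp add: strict upd[OF y'] gmapD(2)[OF F_gmap mem] gmapD(2)[OF F_gmap xi] map_update)
    show "G (m n (xs[i := scl E c (xs ! i)])) = G (scl E c (m n xs))"
      using M2(3)[of i c] xs i gc
      by (simp add: strict upd[OF y'] gmapD(2)[OF G_gmap mem] gmapD(2)[OF G_gmap xi] map_update)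
  qed
qed

lemma m_has_degree:
  assumes n: "n \<ge> 1"
  shows "has_degree n (2 - int n) E E (m n)"
  unfolding has_degree_def
proof (intro allI impI)
  fix ds xs assume xs: "length xs = n \<and> homog E ds xs"
  then have "set xs \<subseteq> gcarrier E" using homog_gcarrier[OF E] by blast
  then show "m n xs \<in> grade E (sum_list ds + (2 - int n))"
    using xs n a_infinityD(3)[OF a_inf1 n] a_infinityD(3)[OF a_inf2 n]
      homog_map[OF F_gmap] homog_map[OF G_gmap]
    by (intro reflects_grade)
      (auto simp: strict_morphismD(2)[OF F] strict_morphismD(2)[OF G] has_degree_def)
qed

lemma a_infinity: "a_infinity E m"
  unfolding a_infinity_def stasheff_term_def[symmetric]
proof (intro conjI allI impI)
  fix n :: nat and ds xs
  assume n: "n \<ge> 1" and xs: "length xs = n \<and> homog E ds xs"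
  have gc: "set xs \<subseteq> gcarrier E" using xs homog_gcarrier[OF E] by blast
  let ?I = "{(r, s, t). r + s + t = n \<and> s \<ge> 1}"
  have "sum (stasheff_term ds m1 (map F xs)) ?I = 0" "sum (stasheff_term ds m2 (map G xs)) ?I = 0"
    using a_infinity_stasheff[OF a_inf1 n] a_infinity_stasheff[OF a_inf2 n] xs
      homog_map[OF F_gmap] homog_map[OF G_gmap] by simp_all
  moreover have "F 0 = 0" "G 0 = 0" using F_add[of 0 0] G_add[of 0 0] by simp_all
  ultimately show "sum (stasheff_term ds m xs) ?I = 0"
    using strict_morphism_stasheff_sum[OF m_gcarrier F F_add, of xs n ds]
      strict_morphism_stasheff_sum[OF m_gcarrier G G_add, of xs n ds] xs gc
    by (intro inj) simp_all
qed (use E m_multilinear m_has_degree in auto)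

end

text \<open>Every condition concerns scalars obtained from the form, so a single strict morphism is
  enough and it need not be injective. Nondegeneracy does not transfer this way: an element killed
  by F pairs to zero with everything.\<close>

lemma degenerate_cyclic_pullback:
  fixes E :: "('k::field, 'v::ab_group_add) gvs"
  assumes E: "a_infinity E m" and F: "strict_morphism E m E' m' F"
    and \<gamma>: "\<And>x y. x \<in> gcarrier E \<Longrightarrow> y \<in> gcarrier E \<Longrightarrow> \<gamma> x y = \<gamma>' (F x) (F y)"
    and cyc: "degenerate_cyclic e E' m' \<gamma>'"
  shows "degenerate_cyclic e E m \<gamma>"
  unfolding degenerate_cyclic_def graded_form_def
proof (intro conjI allI impI ballI)
  note gE = a_infinityD(1)[OF E] and Fg = strict_morphismD(1)[OF F]
  have Fc: "x \<in> gcarrier E \<Longrightarrow> F x \<in> gcarrier E'" for x by (rule gmap_gcarrier[OF gE Fg])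
  have gc: "x \<in> grade E n \<Longrightarrow> x \<in> gcarrier E" for x n by (rule grade_subset_gcarrier[OF gE])
  have Fgr: "x \<in> grade E n \<Longrightarrow> F x \<in> grade E' n" for x n using gmapD(3)[OF Fg] by simp
  have ml: "multilinear 2 E' ground (\<lambda>xs. \<gamma>' (xs ! 0) (xs ! 1))"
    and hd: "has_degree 2 e E' ground (\<lambda>xs. \<gamma>' (xs ! 0) (xs ! 1))"
    using cyc by (auto simp: degenerate_cyclic_def graded_form_def)
  show "multilinear 2 E ground (\<lambda>xs. \<gamma> (xs ! 0) (xs ! 1))"
    unfolding multilinear_def
  proof (intro allI impI)
    fix xs assume "length xs = 2 \<and> set xs \<subseteq> gcarrier E"
    then obtain x y where xs: "xs = [x, y]" "x \<in> gcarrier E" "y \<in> gcarrier E"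
      using list2_set_subset by blast
    note M = multilinearD[OF ml, of "[F x, F y]"]
    show "\<gamma> (xs ! 0) (xs ! 1) \<in> gcarrier ground \<and>
        (\<forall>i<2. (\<forall>z\<in>gcarrier E. \<gamma> (xs[i := xs ! i + z] ! 0) (xs[i := xs ! i + z] ! 1)
              = \<gamma> (xs ! 0) (xs ! 1) + \<gamma> (xs[i := z] ! 0) (xs[i := z] ! 1)) \<and>
            (\<forall>c. \<gamma> (xs[i := scl E c (xs ! i)] ! 0) (xs[i := scl E c (xs ! i)] ! 1)
              = scl ground c (\<gamma> (xs ! 0) (xs ! 1))))"
      using M(1) M(2)[of 0] M(2)[of 1] M(3)[of 0] M(3)[of 1] xs Fc
      by (auto simp: \<gamma> gcarrier_add[OF gE] gcarrier_scl[OF gE] gmapD(1,2)[OF Fg] less_2_cases_iff)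
  qed
  show "has_degree 2 e E ground (\<lambda>xs. \<gamma> (xs ! 0) (xs ! 1))"
    unfolding has_degree_def
  proof (intro allI impI)
    fix ds xs assume xs: "length xs = 2 \<and> homog E ds xs"
    then have "\<gamma>' (map F xs ! 0) (map F xs ! 1) \<in> grade ground (sum_list ds + e)"
      using hd homog_map[OF Fg, of ds xs] unfolding has_degree_def by (metis length_map)
    then show "\<gamma> (xs ! 0) (xs ! 1) \<in> grade ground (sum_list ds + e)"
      using xs homog_gcarrier[OF gE, of ds xs] by (subst \<gamma>) (auto simp: subset_iff)
  qed
  show "sg (p * q) (\<gamma> y x) = \<gamma> x y" if "x \<in> grade E p" "y \<in> grade E q" for p q x y
    using cyc that Fgr by (simp add: \<gamma> gc[OF that(1)] gc[OF that(2)] degenerate_cyclic_def)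
  fix n :: nat and ds xs d0 x0
  assume n: "n \<ge> 1" and xs: "length xs = n \<and> homog E ds xs \<and> x0 \<in> grade E d0"
  have sub: "set xs \<subseteq> gcarrier E" and x0: "x0 \<in> gcarrier E" and ne: "xs \<noteq> []"
    using xs homog_gcarrier[OF gE] gc n by auto
  have sub': "set (butlast xs) \<subseteq> gcarrier E" using sub by (auto dest: in_set_butlastD)
  have la: "last xs \<in> gcarrier E" using sub ne by auto
  have mc: "length ys = n \<Longrightarrow> set ys \<subseteq> gcarrier E \<Longrightarrow> m n ys \<in> gcarrier E" for ys
    using multilinearD(1)[OF a_infinityD(2)[OF E n]] by blast
  have "\<gamma>' (m' n (map F xs)) (F x0)
      = sg (int n + d0 * sum_list ds) (\<gamma>' (m' n (F x0 # butlast (map F xs))) (last (map F xs)))"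
    using cyc n xs homog_map[OF Fg] Fgr unfolding degenerate_cyclic_def by simp
  moreover have "F (m n xs) = m' n (map F xs)"
    "F (m n (x0 # butlast xs)) = m' n (F x0 # butlast (map F xs))"
    using strict_morphismD(2)[OF F n] xs sub sub' x0 n by (auto simp: map_butlast)
  ultimately show "\<gamma> (m n xs) x0
      = sg (int n + d0 * sum_list ds) (\<gamma> (m n (x0 # butlast xs)) (last xs))"
    using xs n sub sub' x0 la mc ne by (simp add: \<gamma> last_map)
qed

section \<open>Pairing tensors with functionals\<close>

lemma lookup_tscl: "Poly_Mapping.lookup (tscl c t) xs = c * Poly_Mapping.lookup t xs"
  by (simp add: tscl_def map.rep_eq when_def)

lemma module_tscl: "module (tscl :: 'k::field \<Rightarrow> ('k, 'v) fsum \<Rightarrow> _)"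
  by unfold_locales
    (simp_all add: poly_mapping_eq_iff fun_eq_iff lookup_add lookup_tscl algebra_simps)

lemma tlin_superset:
  assumes "finite I" "Poly_Mapping.keys t \<subseteq> I" "\<And>x. sc 0 x = 0"
  shows "tlin sc F t = (\<Sum>xs\<in>I. sc (Poly_Mapping.lookup t xs) (F xs))"
  unfolding tlin_def using assms by (intro sum.mono_neutral_left) (auto simp: in_keys_iff)

lemma tlin_mult_add: "tlin (*) F (t + u) = tlin (*) F t + tlin (*) F (u :: ('k::field, 'v) fsum)"
proof -
  let ?I = "Poly_Mapping.keys t \<union> Poly_Mapping.keys u"
  have "Poly_Mapping.keys (t + u) \<subseteq> ?I" by (rule Poly_Mapping.keys_add)
  then show ?thesis
    by (simp add: tlin_superset[of ?I] lookup_add distrib_right sum.distrib)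
qed

lemma tlin_mult_tscl: "tlin (*) F (tscl c t) = c * tlin (*) F (t :: ('k::field, 'v) fsum)"
proof -
  have "Poly_Mapping.keys (tscl c t) \<subseteq> Poly_Mapping.keys t" by (auto simp: in_keys_iff lookup_tscl)
  then show ?thesis
    by (simp add: tlin_superset[of "Poly_Mapping.keys t"] lookup_tscl sum_distrib_left mult.assoc)
qed

lemma tlin_mult_zero: "tlin (*) F (0 :: ('k::field, 'v) fsum) = 0"
  by (simp add: tlin_def)

lemma tlin_mult_diff: "tlin (*) F (t - u) = tlin (*) F t - tlin (*) F (u :: ('k::field, 'v) fsum)"
  using tlin_mult_add[of F "t - u" u] by simp

lemma tlin_mult_pure: "tlin (*) F (pure xs) = (F xs :: 'k::field)"
  by (simp add: tlin_def pure_def)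

lemma tlin_mult_sum:
  "tlin (*) F (\<Sum>i\<in>I. t i) = (\<Sum>i\<in>I. tlin (*) F (t i :: ('k::field, 'v) fsum))"
  by (induction I rule: infinite_finite_induct) (simp_all add: tlin_mult_zero tlin_mult_add)

lemma tlin_tmap: "tlin (*) F (tmap h t) = tlin (*) (\<lambda>xs. F (map h xs)) (t :: ('k::field, 'v) fsum)"
  by (simp add: tmap_def tlin_def[of tscl] tlin_mult_sum tlin_mult_tscl tlin_mult_pure)
    (simp add: tlin_def)

lemma tmap_tensors:
  assumes "t \<in> tensors n"
  shows "tmap h t \<in> tensors n"
proof -
  have "length xs = n" if xs: "xs \<in> Poly_Mapping.keys (tmap h t)" for xs
  proof -
    obtain ys where "ys \<in> Poly_Mapping.keys t"
      "xs \<in> Poly_Mapping.keys (tscl (Poly_Mapping.lookup t ys) (pure (map h ys)))"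
      using xs Poly_Mapping.keys_sum[of "\<lambda>xs. tscl (Poly_Mapping.lookup t xs) (pure (map h xs))"]
      unfolding tmap_def tlin_def by blast
    then have "xs = map h ys"
      by (auto simp: in_keys_iff lookup_tscl pure_def lookup_single when_def split: if_splits)
    then show ?thesis using \<open>ys \<in> _\<close> assms by (auto simp: tensors_def)
  qed
  then show ?thesis by (auto simp: tensors_def)
qed

text \<open>The restriction to lists of length two is needed because \<open>tensor_relations\<close> mixes all tensor
  powers, and a functional reading only two entries does not respect the relations in length three.\<close>

lemma teq_bilinear:
  fixes b :: "'v::ab_group_add \<Rightarrow> 'v \<Rightarrow> 'k::field"
  assumes add: "\<And>x y z. b (x + y) z = b x z + b y z" "\<And>x y z. b z (x + y) = b z x + b z y"
    and scl: "\<And>c x z. b (scl V c x) z = c * b x z" "\<And>c x z. b z (scl V c x) = c * b z x"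
    and tu: "teq V t u" "t \<in> tensors 2" "u \<in> tensors 2"
  shows "tlin (*) (\<lambda>xs. b (xs ! 0) (xs ! 1)) t = tlin (*) (\<lambda>xs. b (xs ! 0) (xs ! 1)) u"
proof -
  define F where "F xs = (if length xs = 2 then b (xs ! 0) (xs ! 1) else 0)" for xs
  have F: "tlin (*) (\<lambda>xs. b (xs ! 0) (xs ! 1)) t = tlin (*) F t" if "t \<in> tensors 2" for t
    using that by (auto simp: tlin_def F_def tensors_def intro!: sum.cong)
  have rel: "tlin (*) F r = 0" if "r \<in> tensor_relations V" for r
  proof -
    \<comment> \<open>A marked entry in a list of length two leaves one other entry, before or after
      it, so each relation varies exactly one argument of b.\<close>
    have split: "length (xs @ z # ys) = 2 \<Longrightarrow> (\<exists>w. xs = [] \<and> ys = [w]) \<or> (\<exists>w. xs = [w] \<and> ys = [])"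
      for xs ys and z :: 'v
      by (cases xs; cases ys) (auto simp: numeral_2_eq_2)
    have F_add: "F (xs @ (x + y) # ys) = F (xs @ x # ys) + F (xs @ y # ys)" for xs x y ys
      using split[of xs x ys] by (auto simp: F_def add nth_append)
    have F_scl: "F (xs @ scl V c x # ys) = c * F (xs @ x # ys)" for xs x c ys
      using split[of xs x ys] by (auto simp: F_def scl nth_append)
    show ?thesis
      using that unfolding tensor_relations_def
      by (auto simp: tlin_mult_diff tlin_mult_tscl tlin_mult_pure F_add F_scl)
  qed
  have "t - u \<in> module.span tscl (tensor_relations V)" using tu by (simp add: teq_def)
  then have "tlin (*) F (t - u) = 0"
  proof (rule module.span_induct[OF module_tscl])
    show "module.subspace tscl {r. tlin (*) F r = 0}"
      by (simp add: module.subspace_def[OF module_tscl] tlin_mult_zero tlin_mult_add tlin_mult_tscl)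
  qed (simp add: rel)
  then show ?thesis using F tu by (simp add: tlin_mult_diff)
qed

lemma dual_linear:
  assumes "gcarrier V = UNIV" "f \<in> grade (dual V) n"
  shows "f (x + y) = f x + f y" "f (scl V c x) = c * f x"
  using assms by (auto simp: grade_dual gmap_def ground_def)

text \<open>The Koszul sign depends on the degree of the first tensor factor, but f is nonzero only
  on factors of degree -r. The sign is therefore constant, and what remains is a bilinear functional
  to which \<open>teq_bilinear\<close> applies.\<close>

lemma tpair_eq:
  fixes V :: "('k::field, 'v::ab_group_add) gvs"
  assumes V: "graded_space V" "gcarrier V = UNIV" and f: "f \<in> grade (dual V) r"
  shows "tpair V s f g t = sg (s * r) (tlin (*) (\<lambda>xs. f (xs ! 0) * g (xs ! 1)) t)"
proof -
  have "hlin V (\<lambda>n y. sg (s * n) (f y * c)) x = sg (s * r) (f x * c)" for x c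
  proof -
    have "sg (s * n) (f y * c) = sg (s * r) (f y * c)" if "y \<in> grade V n" for n y
      using dual_grade_vanishes[OF f that]
      \<comment> \<open>Either n and r have equal parity, so the two signs agree, or both sides
        vanish.\<close>
      by (cases "n + r = 0") (auto simp: sg_def even_mult_iff add_eq_0_iff)
    then have "hlin V (\<lambda>n y. sg (s * n) (f y * c)) x = hlin V (\<lambda>n y. sg (s * r) (f y * c)) x"
      using V by (intro hlin_cong) auto
    also have "\<dots> = sg (s * r) (f x * c)"
      using V by (intro hlin_additive) (auto simp: dual_linear[OF V(2) f] distrib_right sg_add)
    finally show ?thesis .
  qed
  then show ?thesis
    by (simp add: tpair_def tlin_def sg_def sum_negf)
qed

text \<open>Composing both functionals with h amounts to evaluating them on \<open>tmap h t\<close>,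
  and the constant signs agree because f and \<open>f \<circ> h\<close> have the same degree. The
  passage from \<open>tmap h t\<close> to u is invariance of bilinear functionals under the tensor
  relations.\<close>

lemma tpair_tmap:
  fixes V :: "('k::field, 'v::ab_group_add) gvs" and W :: "('k, 'w::ab_group_add) gvs"
  assumes V: "graded_space V" "gcarrier V = UNIV" and W: "graded_space W" "gcarrier W = UNIV"
    and h: "f \<circ> h \<in> grade (dual V) r" and f: "f \<in> grade (dual W) r" and g: "g \<in> grade (dual W) s"
    and tu: "teq W (tmap h t) u" "t \<in> tensors 2" "u \<in> tensors 2"
  shows "tpair V s (f \<circ> h) (g \<circ> h) t = tpair W s f g u"
proof -
  have "tlin (*) (\<lambda>xs. (f \<circ> h) (xs ! 0) * (g \<circ> h) (xs ! 1)) t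
      = tlin (*) (\<lambda>xs. f (map h xs ! 0) * g (map h xs ! 1)) t"
    using tu(2) by (auto simp: tlin_def tensors_def intro!: sum.cong)
  also have "\<dots> = tlin (*) (\<lambda>xs. f (xs ! 0) * g (xs ! 1)) (tmap h t)"
    by (simp add: tlin_tmap)
  also have "\<dots> = tlin (*) (\<lambda>xs. f (xs ! 0) * g (xs ! 1)) u"
    by (rule teq_bilinear[OF _ _ _ _ tu(1) tmap_tensors[OF tu(2)] tu(3)])
      (simp_all add: dual_linear[OF W(2) f] dual_linear[OF W(2) g] algebra_simps)
  finally show ?thesis by (simp add: tpair_eq[OF V h] tpair_eq[OF W f])
qed

section \<open>The extension of a morphism\<close>

lemma ext_grade:
  "x \<in> grade (ext_space d A M) n \<longleftrightarrow> fst x \<in> grade A n \<and> snd x \<in> grade (dual M) (n + (d - 1))"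
  by (simp add: ext_space_def dsum_def shift_def mem_Times_iff)

lemma ext_gcarrier: "x \<in> gcarrier (ext_space d A M) \<longleftrightarrow> fst x \<in> gcarrier A \<and> snd x \<in> gcarrier (dual M)"
  by (simp add: ext_space_def gcarrier_dsum gcarrier_shift mem_Times_iff)

lemma ext_graded_space:
  "graded_space A \<Longrightarrow> graded_space M \<Longrightarrow> gcarrier M = UNIV \<Longrightarrow> graded_space (ext_space d A M)"
  unfolding ext_space_def by (intro graded_space_dsum graded_space_shift graded_space_dual)

lemma ext_scl: "scl (ext_space d A M) c x = (scl A c (fst x), scl (dual M) c (snd x))"
  by (simp add: ext_space_def dsum_def shift_def split_beta)

lemma ext_summand:
  "x \<in> summand (ext_space d A M) 0 \<longleftrightarrow> fst x \<in> gcarrier A \<and> snd x \<in> gcarrier (dual M) \<and> snd x = 0"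
  "x \<in> summand (ext_space d A M) (Suc 0) \<longleftrightarrow> fst x \<in> gcarrier A \<and> snd x \<in> gcarrier (dual M) \<and> fst x = 0"
  by (auto simp: summand_def ext_gcarrier)

lemma Phi_A_simps [simp]: "fst (Phi_A \<phi> x) = fst x" "snd (Phi_A \<phi> x) = snd x \<circ> \<phi>"
  by (simp_all add: Phi_A_def)

lemma Phi_B_simps [simp]: "fst (Phi_B \<phi> x) = \<phi> (fst x)" "snd (Phi_B \<phi> x) = snd x"
  by (simp_all add: Phi_B_def)

lemma dual_additive:
  fixes V :: "('k::field, 'v::ab_group_add) gvs"
  assumes "graded_space V" "gcarrier V = UNIV" "f \<in> gcarrier (dual V)"
  shows "f (x + y) = f x + f y" "f 0 = 0"
proof -
  show *: "f (x + y) = f x + f y" for x y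
    using graded_space_dual[OF assms(1,2)] assms(3)
    by (induction rule: gcarrier_sum_induct) (simp_all add: dual_linear[OF assms(2)])
  show "f 0 = 0" using *[of 0 0] by (metis add_0 add_cancel_left_left)
qed

lemma dg_algebraD:
  assumes "dg_algebra V \<mu> \<delta>" "gcarrier V = UNIV"
  shows "graded_space V" "\<delta> (x + y) = \<delta> x + \<delta> y" "\<delta> 0 = 0"
    "\<mu> (x + y) z = \<mu> x z + \<mu> y z" "\<mu> x (y + z) = \<mu> x y + \<mu> x z" "\<mu> 0 x = 0" "\<mu> x 0 = 0"
    "\<mu> (\<mu> x y) z = \<mu> x (\<mu> y z)"
proof -
  have \<delta>: "gmap 1 V V \<delta>" and \<mu>: "multilinear 2 V V (\<lambda>xs. \<mu> (xs ! 0) (xs ! 1))"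
    using assms by (auto simp: dg_algebra_def)
  show V: "graded_space V" using assms by (simp add: dg_algebra_def)
  show "\<delta> (x + y) = \<delta> x + \<delta> y" "\<delta> 0 = 0"
    using gmapD(1)[OF \<delta>] gmap_zero[OF V \<delta>] assms(2) by auto
  show l: "\<mu> (x + y) z = \<mu> x z + \<mu> y z" and r: "\<mu> x (y + z) = \<mu> x y + \<mu> x z" for x y z
    using multilinearD(2)[OF \<mu>, of "[x, z]" 0 y] multilinearD(2)[OF \<mu>, of "[x, y]" 1 z] assms(2)
    by simp_all
  show "\<mu> 0 x = 0" "\<mu> x 0 = 0" using l[of 0 0 x] r[of x 0 0] by simp_all
  show "\<mu> (\<mu> x y) z = \<mu> x (\<mu> y z)" using assms by (simp add: dg_algebra_def)
qed

lemma dg_algebra_grade_mul: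
  assumes "dg_algebra V \<mu> \<delta>" "x \<in> grade V p" "y \<in> grade V q"
  shows "\<mu> x y \<in> grade V (p + q)"
proof -
  have "homog V [p, q] [x, y]" using assms(2,3) by (simp add: homog_def)
  then have "\<mu> ([x, y] ! 0) ([x, y] ! 1) \<in> grade V (sum_list [p, q] + 0)"
    using assms(1) unfolding dg_algebra_def has_degree_def
    by (metis length_Cons list.size(3) numeral_2_eq_2)
  then show ?thesis by simp
qed

locale dg_morphism =
  fixes d :: int
    and A :: "('k::field, 'a::ab_group_add) gvs" and \<mu>A :: "'a \<Rightarrow> 'a \<Rightarrow> 'a" and \<delta>A :: "'a \<Rightarrow> 'a"
    and B :: "('k, 'b::ab_group_add) gvs" and \<mu>B :: "'b \<Rightarrow> 'b \<Rightarrow> 'b" and \<delta>B :: "'b \<Rightarrow> 'b"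
    and \<phi> :: "'a \<Rightarrow> 'b"
  assumes dgA: "dg_algebra A \<mu>A \<delta>A" and A_UNIV: "gcarrier A = UNIV"
    and dgB: "dg_algebra B \<mu>B \<delta>B" and B_UNIV: "gcarrier B = UNIV"
    and \<phi>: "gmap 0 A B \<phi>" and \<phi>_mul: "\<phi> (\<mu>A x y) = \<mu>B (\<phi> x) (\<phi> y)" and \<phi>_dif: "\<phi> (\<delta>A x) = \<delta>B (\<phi> x)"
begin

abbreviation "E \<equiv> ext_space d A B"
abbreviation "EA \<equiv> ext_space d A A"
abbreviation "EB \<equiv> ext_space d B B"
abbreviation "\<gamma> \<equiv> ext_form d A B \<phi>"
abbreviation "\<gamma>A \<equiv> ext_form d A A id"
abbreviation "\<gamma>B \<equiv> ext_form d B B id"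
abbreviation "dif \<equiv> ext_dif d \<delta>A B \<delta>B"
abbreviation "mul \<equiv> ext_mul d A \<mu>A B (\<lambda>a b. \<mu>B (\<phi> a) b) (\<lambda>b a. \<mu>B b (\<phi> a))"

lemmas A = dg_algebraD[OF dgA A_UNIV] and B = dg_algebraD[OF dgB B_UNIV]

lemma \<phi>_linear: "\<phi> (x + y) = \<phi> x + \<phi> y" "\<phi> (scl A c x) = scl B c (\<phi> x)" "\<phi> 0 = 0"
  using gmapD(1,2)[OF \<phi>] gmap_zero[OF A(1) \<phi>] A_UNIV by auto

lemma dual_A: "graded_space (dual A)" and dual_B: "graded_space (dual B)"
  using graded_space_dual A(1) B(1) A_UNIV B_UNIV by auto

lemma graded_E: "graded_space E" "graded_space EA" "graded_space EB"
  using ext_graded_space A(1) B(1) A_UNIV B_UNIV by auto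

lemma \<phi>_dual: "gmap 0 (dual B) (dual A) (\<lambda>f. f \<circ> \<phi>)"
  unfolding gmap_def
proof (intro conjI ballI allI subsetI)
  fix n h assume "h \<in> (\<lambda>f. f \<circ> \<phi>) ` grade (dual B) n"
  then obtain f where f: "h = f \<circ> \<phi>" "f \<in> grade (dual B) n" by blast
  have "gmap n A ground (f \<circ> \<phi>)"
    unfolding gmap_def
    using f(2) dual_linear[OF B_UNIV f(2)] \<phi>_linear gmapD(3)[OF \<phi>]
    by (auto simp: grade_dual gmap_def ground_def image_subset_iff)
  then show "h \<in> grade (dual A) (n + 0)" using f by (simp add: grade_dual)
qed (auto simp: dual_def fun_eq_iff)

lemma Phi_A_gmap: "gmap 0 E EA (Phi_A \<phi>)"
  using gmapD(3)[OF \<phi>_dual]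
  by (auto simp: gmap_def ext_scl ext_grade prod_eq_iff fun_eq_iff dual_def)

lemma Phi_B_gmap: "gmap 0 E EB (Phi_B \<phi>)"
  using gmapD(3)[OF \<phi>]
  by (auto simp: gmap_def ext_scl ext_grade prod_eq_iff \<phi>_linear)

lemma Phi_add: "Phi_A \<phi> (x + y) = Phi_A \<phi> x + Phi_A \<phi> y" "Phi_B \<phi> (x + y) = Phi_B \<phi> x + Phi_B \<phi> y"
  for x y :: "'a \<times> ('b \<Rightarrow> 'k)"
  by (auto simp: prod_eq_iff fun_eq_iff \<phi>_linear)

lemma dual_B_zero: "f \<in> grade (dual B) n \<Longrightarrow> f 0 = 0"
  using dual_additive(2)[OF B(1) B_UNIV] grade_subset_gcarrier[OF dual_B] by blast

text \<open>The sign in the dual differential is governed by the degree of the functional, which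
  precomposition with \<open>\<phi>\<close> preserves. Beneath the sign stands the equality of
  \<open>f \<circ> \<delta>B \<circ> \<phi>\<close> and
  \<open>f \<circ> \<phi> \<circ> \<delta>A\<close>.\<close>

lemma Phi_A_dif:
  assumes "x \<in> gcarrier E"
  shows "Phi_A \<phi> (dif x) = ext_dif d \<delta>A A \<delta>A (Phi_A \<phi> x)"
proof -
  have f: "snd x \<in> gcarrier (dual B)" using assms by (simp add: ext_gcarrier)
  have "dual_dif B \<delta>B (snd x) (\<phi> c) = dual_dif A \<delta>A (snd x \<circ> \<phi>) c" for c
  proof -
    have "dual_dif A \<delta>A (snd x \<circ> \<phi>) = hlin (dual B) (\<lambda>n g. - sg n ((g \<circ> \<phi>) \<circ> \<delta>A)) (snd x)"
      unfolding dual_dif_def by (rule hlin_gmap[OF dual_B dual_A \<phi>_dual f]) (simp add: fun_eq_iff)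
    then show ?thesis by (simp add: dual_dif_def hlin_apply \<phi>_dif)
  qed
  then show ?thesis
    by (simp add: ext_dif_def shift_dif_def prod_eq_iff fun_eq_iff)
qed

lemma Phi_B_dif: "Phi_B \<phi> (dif x) = ext_dif d \<delta>B B \<delta>B (Phi_B \<phi> x)"
  by (simp add: ext_dif_def prod_eq_iff \<phi>_dif)

text \<open>The sign involves the degrees of a, of f and of the argument. The first is common to
  both sides; the other two are transported by naturality, along precomposition with
  \<open>\<phi>\<close> and along \<open>\<phi>\<close> itself.\<close>

lemma dual_left_Phi_A:
  assumes "f \<in> gcarrier (dual B)"
  shows "dual_left A B (\<lambda>b a. \<mu>B b (\<phi> a)) a f (\<phi> c) = dual_left A A \<mu>A a (f \<circ> \<phi>) c"
proof -
  have "hlin (dual A) (\<lambda>q f'. hlin A (\<lambda>n c'. sg (p * (q + n)) (f' (\<mu>A c' a'))) c) (f \<circ> \<phi>)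
      = hlin (dual B) (\<lambda>q f'. hlin B (\<lambda>n c'. sg (p * (q + n)) (f' (\<mu>B c' (\<phi> a')))) (\<phi> c)) f"
    for p a'
  proof -
    have "hlin (dual A) (\<lambda>q f'. hlin A (\<lambda>n c'. sg (p * (q + n)) (f' (\<mu>A c' a'))) c) (f \<circ> \<phi>)
        = hlin (dual B) (\<lambda>q f'. hlin A (\<lambda>n c'. sg (p * (q + n)) ((f' \<circ> \<phi>) (\<mu>A c' a'))) c) f"
      by (rule hlin_gmap[OF dual_B dual_A \<phi>_dual assms]) (simp add: hlin_def)
    also have "\<dots> = hlin (dual B)
        (\<lambda>q f'. hlin B (\<lambda>n c'. sg (p * (q + n)) (f' (\<mu>B c' (\<phi> a')))) (\<phi> c)) f"
    proof (rule hlin_cong[OF dual_B assms])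
      fix q f' assume "f' \<in> grade (dual B) q"
      then show "hlin A (\<lambda>n c'. sg (p * (q + n)) ((f' \<circ> \<phi>) (\<mu>A c' a'))) c
          = hlin B (\<lambda>n c'. sg (p * (q + n)) (f' (\<mu>B c' (\<phi> a')))) (\<phi> c)"
        by (subst hlin_gmap[OF A(1) B(1) \<phi>]) (simp_all add: A_UNIV B(6) dual_B_zero \<phi>_mul)
    qed
    finally show ?thesis .
  qed
  then show ?thesis by (simp add: dual_left_def)
qed

text \<open>Functional and argument are the same on both sides and only the acting element moves
  along \<open>\<phi>\<close>, so naturality is used once, in the outermost sum.\<close>

lemma dual_left_Phi_B:
  assumes "f \<in> gcarrier (dual B)"
  shows "dual_left A B (\<lambda>b a. \<mu>B b (\<phi> a)) a f = dual_left B B \<mu>B (\<phi> a) f"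
proof -
  \<comment> \<open>This prepares the side condition of \<open>hlin_gmap\<close>: the signed formula
    vanishes when the acting element is zero.\<close>
  have "hlin B (\<lambda>n c'. sg (p * (q + n)) (f' (\<mu>B c' 0))) c = 0"
    if "f' \<in> grade (dual B) q" for p q f' c
    using that by (simp add: B(7) dual_B_zero hlin_def)
  then have "hlin (dual B) (\<lambda>q f'. hlin B (\<lambda>n c'. sg (p * (q + n)) (f' (\<mu>B c' 0))) c) f = 0" for p c
    by (rule hlin_eq_zero[OF _ dual_B assms])
  then show ?thesis
    unfolding dual_left_def fun_eq_iff
    by (subst hlin_gmap[OF A(1) B(1) \<phi>]) (simp_all add: A_UNIV)
qed

lemma Phi_A_mul:
  assumes "x \<in> gcarrier E" "y \<in> gcarrier E"
  shows "Phi_A \<phi> (mul x y) = ext_mul d A \<mu>A A \<mu>A \<mu>A (Phi_A \<phi> x) (Phi_A \<phi> y)"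
  using assms
  by (simp add: ext_mul_def square_zero_mul_def prod_eq_iff fun_eq_iff dual_right_def
      shift_left_def hlin_apply dual_left_Phi_A ext_gcarrier \<phi>_mul)

lemma Phi_B_mul:
  assumes "x \<in> gcarrier E" "y \<in> gcarrier E"
  shows "Phi_B \<phi> (mul x y) = ext_mul d B \<mu>B B \<mu>B \<mu>B (Phi_B \<phi> x) (Phi_B \<phi> y)"
proof -
  have f: "snd y \<in> gcarrier (dual B)" using assms by (simp add: ext_gcarrier)
  have "shift_left (d - 1) B (dual_left B B \<mu>B) (\<phi> (fst x)) (snd y)
      = hlin A (\<lambda>p a'. sg ((d - 1) * p) (dual_left B B \<mu>B (\<phi> a') (snd y))) (fst x)"
    unfolding shift_left_def
    by (rule hlin_gmap[OF A(1) B(1) \<phi>]) (simp_all add: A_UNIV dual_left_def fun_eq_iff B(1))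
  then show ?thesis
    using f
    by (simp add: ext_mul_def square_zero_mul_def prod_eq_iff dual_right_def \<phi>_mul
        shift_left_def dual_left_Phi_B)
qed

lemma form_Phi_A:
  assumes "x \<in> gcarrier E" "y \<in> gcarrier E"
  shows "\<gamma> x y = \<gamma>A (Phi_A \<phi> x) (Phi_A \<phi> y)"
proof -
  have f: "snd y \<in> gcarrier (dual B)" using assms by (simp add: ext_gcarrier)
  have "hlin (dual A) (\<lambda>q f. sg (p * (q - d + 1)) (f a)) (snd y \<circ> \<phi>)
      = hlin (dual B) (\<lambda>q f. sg (p * (q - d + 1)) ((f \<circ> \<phi>) a)) (snd y)" for p a
    by (rule hlin_gmap[OF dual_B dual_A \<phi>_dual f]) simp
  then show ?thesis by (simp add: ext_form_def)
qed

lemma form_Phi_B: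
  assumes "x \<in> gcarrier E" "y \<in> gcarrier E"
  shows "\<gamma> x y = \<gamma>B (Phi_B \<phi> x) (Phi_B \<phi> y)"
proof -
  have f: "snd y \<in> gcarrier (dual B)" using assms by (simp add: ext_gcarrier)
  have "hlin B (\<lambda>p b. hlin (dual B) (\<lambda>q f. sg (p * (q - d + 1)) (f b)) (snd y)) (\<phi> (fst x))
      = hlin A (\<lambda>p a. hlin (dual B) (\<lambda>q f. sg (p * (q - d + 1)) (f (\<phi> a))) (snd y)) (fst x)"
    by (rule hlin_gmap[OF A(1) B(1) \<phi>])
      (auto simp: A_UNIV dual_B_zero intro!: hlin_eq_zero dual_B f)
  then show ?thesis by (simp add: ext_form_def)
qed

end

section \<open>An explicit formula for the product, and its associativity\<close>

context dg_morphism
begin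

text \<open>A functional of degree $q$ can only be nonzero on $c \cdot \phi(a)$ if $q = -|c| - |a|$, so the sign
  $(-1)^{|a|(q+|c|)}$ of the dual action is $(-1)^{|a|}$ independently of $q$.\<close>

lemma ext_left_homogeneous:
  assumes a: "a \<in> grade A p" and f: "f \<in> gcarrier (dual B)"
  shows "shift_left (d - 1) A (dual_left A B (\<lambda>b a. \<mu>B b (\<phi> a))) a f
    = (\<lambda>c. sg (d * p) (f (\<mu>B c (\<phi> a))))"
proof
  fix c
  have \<phi>a: "\<phi> a \<in> grade B p" using gmapD(3)[OF \<phi> a] by simp
  have inner: "hlin B (\<lambda>n c'. sg (p * (q + n)) (f' (\<mu>B c' (\<phi> a)))) c = sg p (f' (\<mu>B c (\<phi> a)))"
    if f': "f' \<in> grade (dual B) q" for q f'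
  proof -
    have "sg (p * (q + n)) (f' (\<mu>B c' (\<phi> a))) = sg p (f' (\<mu>B c' (\<phi> a)))"
      if c': "c' \<in> grade B n" for n c'
    proof -
      from dual_grade_vanishes[OF f' dg_algebra_grade_mul[OF dgB c' \<phi>a]] show ?thesis
        by (cases "n + p + q = 0") (auto simp: sg_def even_mult_iff add_eq_0_iff)
    qed
    then have "hlin B (\<lambda>n c'. sg (p * (q + n)) (f' (\<mu>B c' (\<phi> a)))) c
        = hlin B (\<lambda>n c'. sg p (f' (\<mu>B c' (\<phi> a)))) c"
      using B(1) B_UNIV by (intro hlin_cong) auto
    also have "\<dots> = sg p (f' (\<mu>B c (\<phi> a)))"
      using B(1) B_UNIV
      by (intro hlin_additive) (auto simp: B(4) dual_linear[OF B_UNIV f'] sg_add)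
    finally show ?thesis .
  qed
  have "hlin (dual B) (\<lambda>q f'. hlin B (\<lambda>n c'. sg (p * (q + n)) (f' (\<mu>B c' (\<phi> a)))) c) f
      = hlin (dual B) (\<lambda>q f'. sg p (f' (\<mu>B c (\<phi> a)))) f"
    by (rule hlin_cong[OF dual_B f inner])
  also have "\<dots> = sg p (f (\<mu>B c (\<phi> a)))"
    by (rule hlin_additive[OF dual_B f]) (simp add: sg_add)
  finally have dl: "hlin (dual B) (\<lambda>q f'. hlin B (\<lambda>n c'. sg (p * (q + n)) (f' (\<mu>B c' (\<phi> a)))) c) f
      = sg p (f (\<mu>B c (\<phi> a)))" .
  have zero: "hlin (dual B) (\<lambda>q f'. hlin B (\<lambda>n c'. sg (k * (q + n)) (f' (\<mu>B c' (\<phi> 0)))) c) f = 0"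
    for k c
    by (rule hlin_eq_zero[OF _ dual_B f])
      (simp add: \<phi>_linear B(7) dual_B_zero hlin_def)
  have "dual_left A B (\<lambda>b a. \<mu>B b (\<phi> a)) a f c = sg p (f (\<mu>B c (\<phi> a)))"
    unfolding dual_left_def by (subst hlin_homogeneous[OF A(1) a]) (simp_all add: zero dl)
  moreover have "shift_left (d - 1) A (dual_left A B (\<lambda>b a. \<mu>B b (\<phi> a))) a f
      = sg ((d - 1) * p) (dual_left A B (\<lambda>b a. \<mu>B b (\<phi> a)) a f)"
    unfolding shift_left_def
    by (rule hlin_homogeneous[OF A(1) a]) (simp add: dual_left_def A(1) fun_eq_iff)
  \<comment> \<open>The suspension contributes the exponent \<open>(d - 1) * p\<close> and the dual
    action contributes p, which add up to \<open>d * p\<close>.\<close>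
  ultimately show "shift_left (d - 1) A (dual_left A B (\<lambda>b a. \<mu>B b (\<phi> a))) a f c
      = sg (d * p) (f (\<mu>B c (\<phi> a)))"
    by (simp add: sg_sg algebra_simps)
qed

text \<open>In the explicit product the only sign is attached to the algebra coordinate of the left
  factor, and it is multiplicative in its degree. Associativity thus reduces to that of A and B and
  multiplicativity of \<open>\<phi>\<close>; z never stands on the left and may be
  inhomogeneous.\<close>

lemma mul_assoc_homogeneous:
  assumes x: "x \<in> grade E p" and y: "y \<in> grade E q" and z: "z \<in> gcarrier E"
    and yz: "mul y z \<in> gcarrier E"
  shows "mul (mul x y) z = mul x (mul y z)"
proof -
  have f: "snd z \<in> gcarrier (dual B)" "snd y \<in> gcarrier (dual B)"
    using z grade_subset_gcarrier[OF graded_E(1) y] by (auto simp: ext_gcarrier)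
  have yz': "snd (mul y z) \<in> gcarrier (dual B)" using yz by (simp add: ext_gcarrier)
  have ab: "fst x \<in> grade A p" "fst y \<in> grade A q" using x y by (auto simp: ext_grade)

  have mul_eq: "mul u v = (\<mu>A (fst u) (fst v),
      \<lambda>c. snd u (\<mu>B (\<phi> (fst v)) c) + sg (d * k) (snd v (\<mu>B c (\<phi> (fst u)))))"
    if "fst u \<in> grade A k" "snd v \<in> gcarrier (dual B)" for u v k
    using ext_left_homogeneous[OF that]
    by (simp add: ext_mul_def square_zero_mul_def dual_right_def fun_eq_iff)
  have "fst (mul x y) \<in> grade A (p + q)"
    using dg_algebra_grade_mul[OF dgA ab] by (simp add: ext_mul_def square_zero_mul_def)
  from mul_eq[OF this f(1)] mul_eq[OF ab(1) yz'] show ?thesis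
    unfolding mul_eq[OF ab(1) f(2)] mul_eq[OF ab(2) f(1)]
    by (simp add: A(8) B(8) \<phi>_mul fun_eq_iff sg_add sg_sg algebra_simps)
qed

end

section \<open>Comparison of the ternary operations through the double brackets\<close>

locale double_poisson_extension = dg_morphism d A \<mu>A \<delta>A B \<mu>B \<delta>B \<phi>
  for d :: int
    and A :: "('k::field, 'a::ab_group_add) gvs" and \<mu>A :: "'a \<Rightarrow> 'a \<Rightarrow> 'a" and \<delta>A :: "'a \<Rightarrow> 'a"
    and B :: "('k, 'b::ab_group_add) gvs" and \<mu>B :: "'b \<Rightarrow> 'b \<Rightarrow> 'b" and \<delta>B :: "'b \<Rightarrow> 'b"
    and \<phi> :: "'a \<Rightarrow> 'b" +
  fixes brA :: "'a \<Rightarrow> 'a \<Rightarrow> ('k, 'a) fsum" and brB :: "'b \<Rightarrow> 'b \<Rightarrow> ('k, 'b) fsum"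
    and mA :: "nat \<Rightarrow> ('a \<times> ('a \<Rightarrow> 'k)) list \<Rightarrow> 'a \<times> ('a \<Rightarrow> 'k)"
    and mB :: "nat \<Rightarrow> ('b \<times> ('b \<Rightarrow> 'k)) list \<Rightarrow> 'b \<times> ('b \<Rightarrow> 'k)"
  assumes brA: "brA a a' \<in> tensors 2" and brB: "brB b b' \<in> tensors 2"
    and \<phi>_br: "teq B (tmap \<phi> (brA a a')) (brB (\<phi> a) (\<phi> a'))"
    and corrA: "corresponding_structure d A \<mu>A \<delta>A brA mA"
    and corrB: "corresponding_structure d B \<mu>B \<delta>B brB mB"
begin

lemma mA:
  shows "a_infinity EA mA" "nice EA mA" "cyclic_structure (d - 1) EA mA \<gamma>A"
    "x \<in> gcarrier EA \<Longrightarrow> mA 1 [x] = ext_dif d \<delta>A A \<delta>A x"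
    "x \<in> gcarrier EA \<Longrightarrow> y \<in> gcarrier EA \<Longrightarrow> mA 2 [x, y] = ext_mul d A \<mu>A A \<mu>A \<mu>A x y"
    "a \<in> grade A p \<Longrightarrow> b \<in> grade A q \<Longrightarrow> f \<in> grade (dual A) r \<Longrightarrow> g \<in> grade (dual A) s \<Longrightarrow>
      tpair A s f g (brA a b) = sg (q * (p + s + 1)) (\<gamma>A (mA 3 [(b, 0), (0, g), (a, 0)]) (0, f))"
  using corrA unfolding corresponding_structure_def Let_def by blast+

lemma mB:
  shows "a_infinity EB mB" "nice EB mB" "cyclic_structure (d - 1) EB mB \<gamma>B"
    "x \<in> gcarrier EB \<Longrightarrow> mB 1 [x] = ext_dif d \<delta>B B \<delta>B x"
    "x \<in> gcarrier EB \<Longrightarrow> y \<in> gcarrier EB \<Longrightarrow> mB 2 [x, y] = ext_mul d B \<mu>B B \<mu>B \<mu>B x y"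
    "a \<in> grade B p \<Longrightarrow> b \<in> grade B q \<Longrightarrow> f \<in> grade (dual B) r \<Longrightarrow> g \<in> grade (dual B) s \<Longrightarrow>
      tpair B s f g (brB a b) = sg (q * (p + s + 1)) (\<gamma>B (mB 3 [(b, 0), (0, g), (a, 0)]) (0, f))"
  using corrB unfolding corresponding_structure_def Let_def by blast+

text \<open>Both sides are, up to the same sign, pairings of functionals with corresponding
  brackets. The order is reversed: the formula for the bracket of a and b puts b in the first slot
  of the ternary operation and a in the third, so the bracket needed here is that of b and a, paired
  with g first and f second.\<close>

lemma form_m3_eq:
  assumes "a \<in> grade A p" "b \<in> grade A q" "f \<in> grade (dual B) r" "g \<in> grade (dual B) s"
  shows "\<gamma>A (mA 3 [(a, 0), (0, f \<circ> \<phi>), (b, 0)]) (0, g \<circ> \<phi>)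
    = \<gamma>B (mB 3 [(\<phi> a, 0), (0, f), (\<phi> b, 0)]) (0, g)"
proof -
  have \<phi>_grade: "\<phi> a \<in> grade B p" "\<phi> b \<in> grade B q"
    "f \<circ> \<phi> \<in> grade (dual A) r" "g \<circ> \<phi> \<in> grade (dual A) s"
    using assms gmapD(3)[OF \<phi>] gmapD(3)[OF \<phi>_dual] by auto
  have "tpair A r (g \<circ> \<phi>) (f \<circ> \<phi>) (brA b a) = tpair B r g f (brB (\<phi> b) (\<phi> a))"
    by (rule tpair_tmap[OF A(1) A_UNIV B(1) B_UNIV \<phi>_grade(4) assms(4,3) \<phi>_br brA brB])
  then show ?thesis
    by (simp add: mA(6)[OF assms(2,1) \<phi>_grade(4,3)] mB(6)[OF \<phi>_grade(2,1) assms(4,3)])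
qed

end

lemma alternating3: "alternating [i, j, k] \<longleftrightarrow> i \<noteq> j \<and> j \<noteq> k"
  by (auto simp: alternating_def less_Suc_eq nth_Cons split: nat.splits)

lemma good_map_3:
  assumes "good_map E 3 f" "x \<in> summand E i" "y \<in> summand E j" "z \<in> summand E k" "{i, j, k} \<subseteq> {0, 1}"
  shows "i = j \<or> j = k \<Longrightarrow> f [x, y, z] = 0" "i \<noteq> j \<Longrightarrow> j \<noteq> k \<Longrightarrow> f [x, y, z] \<in> summand E i"
  using assms unfolding good_map_def
  by (auto simp: alternating3 dest!: spec[of _ "[i, j, k]"] spec[of _ "[x, y, z]"])

lemma nice_good_map: "nice E m \<Longrightarrow> odd n \<Longrightarrow> good_map E n (m n)"
  by (simp add: nice_def good_def)

lemma trilinearD: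
  assumes "multilinear 3 V W f" "x \<in> gcarrier V" "y \<in> gcarrier V" "z \<in> gcarrier V"
  shows "f [x, y, z] \<in> gcarrier W"
    "u \<in> gcarrier V \<Longrightarrow> f [x + u, y, z] = f [x, y, z] + f [u, y, z]"
    "u \<in> gcarrier V \<Longrightarrow> f [x, y + u, z] = f [x, y, z] + f [x, u, z]"
    "u \<in> gcarrier V \<Longrightarrow> f [x, y, z + u] = f [x, y, z] + f [x, y, u]"
    "f [scl V c x, y, z] = scl W c (f [x, y, z])"
    "f [x, scl V c y, z] = scl W c (f [x, y, z])"
    "f [x, y, scl V c z] = scl W c (f [x, y, z])"
proof -
  note M = multilinearD[OF assms(1), of "[x, y, z]"]
  show "f [x, y, z] \<in> gcarrier W" using M(1) assms by simp
  show "u \<in> gcarrier V \<Longrightarrow> f [x + u, y, z] = f [x, y, z] + f [u, y, z]"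
    "u \<in> gcarrier V \<Longrightarrow> f [x, y + u, z] = f [x, y, z] + f [x, u, z]"
    "u \<in> gcarrier V \<Longrightarrow> f [x, y, z + u] = f [x, y, z] + f [x, y, u]"
    using M(2)[of 0 u] M(2)[of 1 u] M(2)[of 2 u] assms by simp_all
  show "f [scl V c x, y, z] = scl W c (f [x, y, z])"
    "f [x, scl V c y, z] = scl W c (f [x, y, z])"
    "f [x, y, scl V c z] = scl W c (f [x, y, z])"
    using M(3)[of 0 c] M(3)[of 1 c] M(3)[of 2 c] assms by simp_all
qed

lemma less_3_cases: "(i::nat) < 3 \<Longrightarrow> i = 0 \<or> i = 1 \<or> i = 2"
  by auto

lemma trilinearI:
  assumes "\<And>x y z. x \<in> gcarrier V \<Longrightarrow> y \<in> gcarrier V \<Longrightarrow> z \<in> gcarrier V \<Longrightarrow> f [x, y, z] \<in> gcarrier W"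
    and "\<And>x y z u. x \<in> gcarrier V \<Longrightarrow> y \<in> gcarrier V \<Longrightarrow> z \<in> gcarrier V \<Longrightarrow> u \<in> gcarrier V \<Longrightarrow>
      f [x + u, y, z] = f [x, y, z] + f [u, y, z] \<and> f [x, y + u, z] = f [x, y, z] + f [x, u, z] \<and>
      f [x, y, z + u] = f [x, y, z] + f [x, y, u]"
    and "\<And>x y z c. x \<in> gcarrier V \<Longrightarrow> y \<in> gcarrier V \<Longrightarrow> z \<in> gcarrier V \<Longrightarrow>
      f [scl V c x, y, z] = scl W c (f [x, y, z]) \<and> f [x, scl V c y, z] = scl W c (f [x, y, z]) \<and>
      f [x, y, scl V c z] = scl W c (f [x, y, z])"
  shows "multilinear 3 V W f"
  unfolding multilinear_def
proof (intro allI impI)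
  fix xs assume "length xs = 3 \<and> set xs \<subseteq> gcarrier V"
  then obtain x y z where "xs = [x, y, z]" "x \<in> gcarrier V" "y \<in> gcarrier V" "z \<in> gcarrier V"
    by (auto simp: numeral_3_eq_3 length_Suc_conv)
  then show "f xs \<in> gcarrier W \<and>
        (\<forall>i<3. (\<forall>y\<in>gcarrier V. f (xs[i := xs ! i + y]) = f xs + f (xs[i := y])) \<and>
               (\<forall>c. f (xs[i := scl V c (xs ! i)]) = scl W c (f xs)))"
    using assms by (auto dest!: less_3_cases)
qed

context double_poisson_extension
begin

text \<open>These are the values in which the signed summand of the form drops out, because the
  right argument has no dual coordinate or the left one has no algebra coordinate.\<close>

lemma form_simps:
  "\<gamma>A (u, h) (v, 0) = h v" "\<gamma>A (0, h) y = h (fst y)"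
  "\<gamma>B (u', h') (v', 0) = h' v'" "\<gamma>B (0, h') y' = h' (fst y')"
  by (simp_all add: ext_form_def A(1) B(1) dual_A dual_B) (simp_all add: hlin_def)

lemma \<gamma>B_multilinear: "multilinear 2 EB ground (\<lambda>xs. \<gamma>B (xs ! 0) (xs ! 1))"
  using mB(3) by (auto simp: cyclic_structure_def degenerate_cyclic_def graded_form_def)

lemma \<gamma>B_add:
  assumes "x \<in> gcarrier EB" "y \<in> gcarrier EB" "z \<in> gcarrier EB"
  shows "\<gamma>B (x + y) z = \<gamma>B x z + \<gamma>B y z" "\<gamma>B x (y + z) = \<gamma>B x y + \<gamma>B x z"
  using multilinearD(2)[OF \<gamma>B_multilinear, of "[x, z]" 0 y]
    multilinearD(2)[OF \<gamma>B_multilinear, of "[x, y]" 1 z] assms by simp_all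

text \<open>Nondegeneracy asks for vanishing against the whole extension. The difference
  \<open>?w\<close> has no dual coordinate, so it pairs to zero with B automatically; against the
  dual, the hypothesis on homogeneous g extends by additivity.\<close>

lemma \<gamma>B_separates:
  assumes z: "z \<in> gcarrier EB" "z' \<in> gcarrier EB" "snd z = 0" "snd z' = 0"
    and eq: "\<And>g s. g \<in> grade (dual B) s \<Longrightarrow> \<gamma>B z (0, g) = \<gamma>B z' (0, g)"
  shows "z = z'"
proof -
  let ?w = "(fst z - fst z', 0 :: 'b \<Rightarrow> 'k)"
  have w: "?w \<in> gcarrier EB" by (simp add: ext_gcarrier B_UNIV gcarrier_zero[OF dual_B])
  have zw: "z = ?w + z'" using z by (simp add: prod_eq_iff)
  have in_EB: "(0, g) \<in> gcarrier EB" "(b, 0) \<in> gcarrier EB" if "g \<in> gcarrier (dual B)" for b g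
    using that by (simp_all add: ext_gcarrier B_UNIV gcarrier_zero[OF dual_B])
  have "\<gamma>B ?w (0, g) = 0" if "g \<in> gcarrier (dual B)" for g
    using dual_B that
  proof (induction rule: gcarrier_sum_induct)
    case zero
    show ?case by (simp only: form_simps) simp
  next
    case (add n f g)
    have f: "(0, f) \<in> gcarrier EB"
      using add(1) grade_subset_gcarrier[OF dual_B] in_EB by blast
    have "\<gamma>B ?w (0, f) = 0"
      using eq[OF add(1)] \<gamma>B_add(1)[OF w z(2) f] zw by simp
    then show ?case
      using \<gamma>B_add(2)[OF w f in_EB(1)[OF add(2)]] add(3)
      by (simp del: plus_fun_apply zero_fun_apply id_apply)
  qed
  note odd = this
  have "\<gamma>B ?w y = 0" if "y \<in> gcarrier EB" for y
  proof -
    have y: "snd y \<in> gcarrier (dual B)" using that by (simp add: ext_gcarrier)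
    have "\<gamma>B ?w y = \<gamma>B ?w ((fst y, 0) + (0, snd y))" by simp
    also have "\<dots> = \<gamma>B ?w (fst y, 0) + \<gamma>B ?w (0, snd y)"
      by (rule \<gamma>B_add(2)[OF w in_EB(2)[OF y] in_EB(1)[OF y]])
    also have "\<dots> = 0"
      unfolding odd[OF y] form_simps by simp
    finally show ?thesis .
  qed
  then have "?w = 0" using mB(3) w unfolding cyclic_structure_def by blast
  then show ?thesis using zw by simp
qed

lemma homogeneous_gens:
  "a \<in> grade A p \<Longrightarrow> (a, 0) \<in> summand E 0" "f \<in> grade (dual B) r \<Longrightarrow> (0, f) \<in> summand E 1"
  "a \<in> grade A p \<Longrightarrow> (a, 0) \<in> summand EA 0" "h \<in> grade (dual A) r \<Longrightarrow> (0, h) \<in> summand EA 1"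
  "b \<in> grade B p \<Longrightarrow> (b, 0) \<in> summand EB 0" "f \<in> grade (dual B) r \<Longrightarrow> (0, f) \<in> summand EB 1"
  using grade_subset_gcarrier[OF dual_A] grade_subset_gcarrier[OF dual_B]
  by (auto simp: ext_summand A_UNIV B_UNIV gcarrier_zero dual_A dual_B)

lemma grade_\<phi>: "a \<in> grade A p \<Longrightarrow> \<phi> a \<in> grade B p" "f \<in> grade (dual B) r \<Longrightarrow> f \<circ> \<phi> \<in> grade (dual A) r"
  using gmapD(3)[OF \<phi>] gmapD(3)[OF \<phi>_dual] by auto

lemma summand_gcarrier: "x \<in> summand V i \<Longrightarrow> x \<in> gcarrier V"
  by (simp add: summand_def)

text \<open>By goodness both sides lie in B, so it is enough to pair them with functionals g. On the
  right this moves \<open>\<phi>\<close> from the element to the functional, after which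
  \<open>form_m3_eq\<close> applies.\<close>

lemma mB_3_even:
  assumes a: "a \<in> grade A p" and b: "b \<in> grade A q" and f: "f \<in> grade (dual B) r"
  shows "mB 3 [(\<phi> a, 0), (0, f), (\<phi> b, 0)] = (\<phi> (fst (mA 3 [(a, 0), (0, f \<circ> \<phi>), (b, 0)])), 0)"
proof -
  define X where "X = mA 3 [(a, 0), (0, f \<circ> \<phi>), (b, 0)]"
  define Y where "Y = mB 3 [(\<phi> a, 0), (0, f), (\<phi> b, 0)]"
  have X: "X \<in> summand EA 0"
    unfolding X_def
    by (rule good_map_3(2)[OF nice_good_map[OF mA(2)] homogeneous_gens(3)[OF a]
          homogeneous_gens(4)[OF grade_\<phi>(2)[OF f]] homogeneous_gens(3)[OF b]]) simp_all
  have Y: "Y \<in> summand EB 0"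
    unfolding Y_def
    by (rule good_map_3(2)[OF nice_good_map[OF mB(2)] homogeneous_gens(5)[OF grade_\<phi>(1)[OF a]]
          homogeneous_gens(6)[OF f] homogeneous_gens(5)[OF grade_\<phi>(1)[OF b]]]) simp_all
  have "Y = (\<phi> (fst X), 0)"
  proof (rule \<gamma>B_separates)
    fix g s assume g: "g \<in> grade (dual B) s"
    have "(0 :: 'b \<Rightarrow> 'k) \<circ> \<phi> = 0" by (simp add: fun_eq_iff)
    \<comment> \<open>Both sides equal the form of the mixed extension on \<open>(fst X, 0)\<close>
      and \<open>(0, g)\<close>, computed once through \<open>Phi_B\<close> and once through
      \<open>Phi_A\<close>.\<close>
    then have "\<gamma>B (\<phi> (fst X), 0) (0, g) = \<gamma>A (fst X, 0) (0, g \<circ> \<phi>)"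
      using form_Phi_A[of "(fst X, 0)" "(0, g)"] form_Phi_B[of "(fst X, 0)" "(0, g)"]
        grade_subset_gcarrier[OF dual_B g]
      by (simp add: ext_gcarrier A_UNIV gcarrier_zero[OF dual_B] Phi_A_def Phi_B_def \<phi>_linear)
    also have "(fst X, 0) = X" using X by (simp add: ext_summand prod_eq_iff)
    also have "\<gamma>A X (0, g \<circ> \<phi>) = \<gamma>B Y (0, g)"
      unfolding X_def Y_def by (rule form_m3_eq[OF a b f g])
    finally show "\<gamma>B Y (0, g) = \<gamma>B (\<phi> (fst X), 0) (0, g)" by (rule sym)
  qed (use Y in \<open>auto simp: ext_summand ext_gcarrier B_UNIV gcarrier_zero[OF dual_B]\<close>)
  then show ?thesis by (simp add: X_def Y_def)
qed

text \<open>Evaluating the dual coordinate at a is pairing with \<open>(a, 0)\<close>. Cyclicity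
  moves a into the first slot and releases the last functional, which turns the odd pattern into the
  even one treated by \<open>form_m3_eq\<close>; cyclicity for B then leads back.\<close>

lemma mA_3_odd:
  assumes b: "b \<in> grade A q" and f: "f \<in> grade (dual B) r" and g: "g \<in> grade (dual B) s"
  shows "mA 3 [(0, f \<circ> \<phi>), (b, 0), (0, g \<circ> \<phi>)] = (0, snd (mB 3 [(0, f), (\<phi> b, 0), (0, g)]) \<circ> \<phi>)"
proof -
  define X where "X = mA 3 [(0, f \<circ> \<phi>), (b, 0), (0, g \<circ> \<phi>)]"
  define Y where "Y = mB 3 [(0, f), (\<phi> b, 0), (0, g)]"
  have X: "X \<in> summand EA (Suc 0)"
    unfolding X_def One_nat_def[symmetric]
    by (rule good_map_3(2)[OF nice_good_map[OF mA(2)] homogeneous_gens(4)[OF grade_\<phi>(2)[OF f]]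
          homogeneous_gens(3)[OF b] homogeneous_gens(4)[OF grade_\<phi>(2)[OF g]]]) simp_all
  have Y: "Y \<in> summand EB (Suc 0)"
    unfolding Y_def One_nat_def[symmetric]
    by (rule good_map_3(2)[OF nice_good_map[OF mB(2)] homogeneous_gens(6)[OF f]
          homogeneous_gens(5)[OF grade_\<phi>(1)[OF b]] homogeneous_gens(6)[OF g]]) simp_all
  have hom: "snd X a = snd Y (\<phi> a)" if a: "a \<in> grade A p" for a p
  proof -
    \<comment> \<open>A functional of degree r has degree \<open>r - (d - 1)\<close> after
      suspension. These degrees are the same for A and for B, so the two rotations produce equal
      signs.\<close>
    let ?ds = "[r - (d - 1), q, s - (d - 1)]"
    have cyc: "\<gamma>' (m 3 xs) x0 = sg (int 3 + p * sum_list ?ds) (\<gamma>' (m 3 (x0 # butlast xs)) (last xs))"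
      if "cyclic_structure (d - 1) V m \<gamma>'" "length xs = 3" "homog V ?ds xs" "x0 \<in> grade V p"
      for V :: "('k, 'v::ab_group_add) gvs" and m \<gamma>' xs x0
      using that unfolding cyclic_structure_def degenerate_cyclic_def
      by (metis (no_types) one_le_numeral)
    have "snd X a = \<gamma>A X (a, 0)" using form_simps(1)[of "fst X" "snd X"] by simp
    also have "\<dots> = sg (int 3 + p * sum_list ?ds)
        (\<gamma>A (mA 3 [(a, 0), (0, f \<circ> \<phi>), (b, 0)]) (0, g \<circ> \<phi>))"
      unfolding X_def
      using cyc[OF mA(3), of "[(0, f \<circ> \<phi>), (b, 0), (0, g \<circ> \<phi>)]" "(a, 0)"] a b
        grade_\<phi>(2)[OF f] grade_\<phi>(2)[OF g]
      by (simp add: homog_def ext_grade graded_spaceD(2)[OF A(1)] graded_spaceD(2)[OF dual_A])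
    also have "\<dots> = sg (int 3 + p * sum_list ?ds)
        (\<gamma>B (mB 3 [(\<phi> a, 0), (0, f), (\<phi> b, 0)]) (0, g))"
      by (simp only: form_m3_eq[OF a b f g])
    also have "\<dots> = \<gamma>B Y (\<phi> a, 0)"
      unfolding Y_def
      using cyc[OF mB(3), of "[(0, f), (\<phi> b, 0), (0, g)]" "(\<phi> a, 0)"]
        grade_\<phi>(1)[OF a] grade_\<phi>(1)[OF b] f g
      by (simp add: homog_def ext_grade graded_spaceD(2)[OF B(1)] graded_spaceD(2)[OF dual_B])
    also have "\<dots> = snd Y (\<phi> a)"
      using form_simps(3)[of "fst Y" "snd Y"] by simp
    finally show ?thesis .
  qed
  have dX: "snd X \<in> gcarrier (dual A)" and dY: "snd Y \<in> gcarrier (dual B)"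
    using X Y by (simp_all add: ext_summand)
  \<comment> \<open>Cyclicity is available for homogeneous a only; additivity of both functionals
    gives all a.\<close>
  have "snd X a = snd Y (\<phi> a)" for a
    using A(1) UNIV_I[of a, folded A_UNIV]
  proof (induction rule: gcarrier_sum_induct)
    case zero
    show ?case using dual_additive(2)[OF A(1) A_UNIV dX] dual_additive(2)[OF B(1) B_UNIV dY]
      by (simp add: \<phi>_linear)
  next
    case (add n x y)
    then show ?case
      using dual_additive(1)[OF A(1) A_UNIV dX] dual_additive(1)[OF B(1) B_UNIV dY] hom
      by (simp add: \<phi>_linear)
  qed
  then have "X = (0, snd Y \<circ> \<phi>)" using X by (simp add: prod_eq_iff ext_summand fun_eq_iff)
  then show ?thesis by (simp add: X_def Y_def)
qed

end

section \<open>The ternary operation of the extension: strictness, uniqueness and existence\<close>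

context dg_morphism
begin

text \<open>On triples of such elements the ternary operation is known completely: alternating
  patterns have prescribed values and all others vanish by goodness.\<close>

definition gens :: "('a \<times> ('b \<Rightarrow> 'k)) set" where
  "gens = {(a, 0) | a p. a \<in> grade A p} \<union> {(0, f) | f r. f \<in> grade (dual B) r}"

lemma gcarrier_gens: "gcarrier E = addspan gens"
proof (intro set_eqI iffI)
  fix x assume "x \<in> gcarrier E"
  with graded_E(1) show "x \<in> addspan gens"
  proof (induction rule: gcarrier_sum_induct)
    case zero
    show ?case by (rule addspan.zero)
  next
    case (add n x y)
    have "(fst x, 0) \<in> gens" "(0, snd x) \<in> gens"
      using add(1) by (auto simp: gens_def ext_grade)
    then have "(fst x, 0) + (0, snd x) \<in> addspan gens"
      by (intro addspan.add addspan.base)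
    then show ?case using add by (simp add: addspan.add)
  qed
next
  fix x assume "x \<in> addspan gens"
  then show "x \<in> gcarrier E"
  proof induction
    case (base s)
    then show ?case
      by (auto simp: gens_def ext_gcarrier A_UNIV gcarrier_zero[OF dual_B]
          grade_subset_gcarrier[OF dual_B])
  qed (simp_all add: gcarrier_zero gcarrier_add graded_E(1))
qed

end

context double_poisson_extension
begin

text \<open>All maps involved are multiadditive, so generators suffice. Six of the eight patterns of
  summands are not alternating and vanish on every side. In each of the two remaining ones, one
  compatibility is the prescribed value itself and the other is \<open>mB_3_even\<close> or
  \<open>mA_3_odd\<close>.\<close>

lemma m3_phi_strict:
  assumes m3: "is_m3_phi d A B \<phi> mA mB m3" and xs: "length xs = 3" "set xs \<subseteq> gcarrier E"
  shows "Phi_A \<phi> (m3 xs) = mA 3 (map (Phi_A \<phi>) xs)" "Phi_B \<phi> (m3 xs) = mB 3 (map (Phi_B \<phi>) xs)"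
proof -
  have ml: "multilinear 3 E E m3" and good: "good_map E 3 m3"
    and even: "\<And>a b f p q r. a \<in> grade A p \<Longrightarrow> b \<in> grade A q \<Longrightarrow> f \<in> grade (dual B) r \<Longrightarrow>
      m3 [(a, 0), (0, f), (b, 0)] = (fst (mA 3 [(a, 0), (0, f \<circ> \<phi>), (b, 0)]), 0)"
    and odd: "\<And>b f g q r s. b \<in> grade A q \<Longrightarrow> f \<in> grade (dual B) r \<Longrightarrow> g \<in> grade (dual B) s \<Longrightarrow>
      m3 [(0, f), (b, 0), (0, g)] = (0, snd (mB 3 [(0, f), (\<phi> b, 0), (0, g)]))"
    using m3 unfolding is_m3_phi_def by blast+
  note goodA = good_map_3[OF nice_good_map[OF mA(2)]] and goodB = good_map_3[OF nice_good_map[OF mB(2)]]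
  note good = good_map_3[OF good]
  have agree: "Phi_A \<phi> (m3 ys) = mA 3 (map (Phi_A \<phi>) ys) \<and> Phi_B \<phi> (m3 ys) = mB 3 (map (Phi_B \<phi>) ys)"
    if ys: "length ys = 3" "set ys \<subseteq> gens" for ys
  proof -
    obtain x y z where xyz: "ys = [x, y, z]" "x \<in> gens" "y \<in> gens" "z \<in> gens"
      using ys by (auto simp: numeral_3_eq_3 length_Suc_conv)
    have Phi0: "Phi_A \<phi> (0 :: 'a \<times> ('b \<Rightarrow> 'k)) = 0" "Phi_B \<phi> (0 :: 'a \<times> ('b \<Rightarrow> 'k)) = 0"
      by (simp_all add: prod_eq_iff \<phi>_linear fun_eq_iff)
    have Phi_gens: "Phi_A \<phi> (a, 0 :: 'b \<Rightarrow> 'k) = (a, 0)" "Phi_B \<phi> (a, 0 :: 'b \<Rightarrow> 'k) = (\<phi> a, 0)"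
      "Phi_A \<phi> (0, f) = (0, f \<circ> \<phi>)" "Phi_B \<phi> (0, f) = (0, f)" for a and f :: "'b \<Rightarrow> 'k"
      by (simp_all add: prod_eq_iff \<phi>_linear fun_eq_iff)
    \<comment> \<open>Records at once that x and both its images lie in the summand of the same
      index, so that goodness of all three operations can be applied to one pattern.\<close>
    define ty where "ty x i \<longleftrightarrow> x \<in> summand E i \<and> Phi_A \<phi> x \<in> summand EA i \<and> Phi_B \<phi> x \<in> summand EB i \<and>
        (i = 0 \<longrightarrow> (\<exists>a p. x = (a, 0) \<and> a \<in> grade A p)) \<and>
        (i = 1 \<longrightarrow> (\<exists>f r. x = (0, f) \<and> f \<in> grade (dual B) r))"
      for x :: "'a \<times> ('b \<Rightarrow> 'k)" and i
    have ty: "ty x 0 \<or> ty x 1" if "x \<in> gens" for x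
    proof -
      consider a p where "x = (a, 0)" "a \<in> grade A p" | f r where "x = (0, f)" "f \<in> grade (dual B) r"
        using \<open>x \<in> gens\<close> unfolding gens_def by blast
      then show ?thesis
      proof cases
        case 1
        have "ty x 0"
          unfolding ty_def 1(1) Phi_gens
        proof (intro conjI impI)
          show "(a, 0) \<in> summand E 0" "(a, 0) \<in> summand EA 0" "(\<phi> a, 0) \<in> summand EB 0"
            by (fact homogeneous_gens(1,3)[OF 1(2)] homogeneous_gens(5)[OF grade_\<phi>(1)[OF 1(2)]])+
          show "\<exists>a' p. (a, 0 :: 'b \<Rightarrow> 'k) = (a', 0) \<and> a' \<in> grade A p"
            using 1(2) by blast
        qed simp
        then show ?thesis ..
      next
        case 2
        have "ty x 1"
          unfolding ty_def 2(1) Phi_gens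
        proof (intro conjI impI)
          show "(0, f) \<in> summand E 1" "(0, f \<circ> \<phi>) \<in> summand EA 1" "(0, f) \<in> summand EB 1"
            by (fact homogeneous_gens(2,6)[OF 2(2)] homogeneous_gens(4)[OF grade_\<phi>(2)[OF 2(2)]])+
          show "\<exists>f' r. (0 :: 'a, f) = (0, f') \<and> f' \<in> grade (dual B) r"
            using 2(2) by blast
        qed simp
        then show ?thesis ..
      qed
    qed
    have vanish: ?thesis if "ty x i" "ty y j" "ty z k" "{i, j, k} \<subseteq> {0, 1}" "i = j \<or> j = k" for i j k
      using that good(1)[of x i y j z k] goodA(1)[of "Phi_A \<phi> x" i "Phi_A \<phi> y" j "Phi_A \<phi> z" k]
        goodB(1)[of "Phi_B \<phi> x" i "Phi_B \<phi> y" j "Phi_B \<phi> z" k] Phi0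
      unfolding ty_def xyz(1) by simp
    have even_case: ?thesis if x: "x = (a, 0)" and y: "y = (0, f)" and z: "z = (b, 0)"
      and g: "a \<in> grade A p" "b \<in> grade A q" "f \<in> grade (dual B) r" for a b f p q r
    proof -
      have "mA 3 [(a, 0), (0, f \<circ> \<phi>), (b, 0)] \<in> summand EA 0"
        by (rule goodA(2)[OF _ homogeneous_gens(3)[OF g(1)]
              homogeneous_gens(4)[OF grade_\<phi>(2)[OF g(3)]] homogeneous_gens(3)[OF g(2)]]) simp_all
      then have "(fst (mA 3 [(a, 0), (0, f \<circ> \<phi>), (b, 0)]), 0) = mA 3 [(a, 0), (0, f \<circ> \<phi>), (b, 0)]"
        by (simp add: ext_summand prod_eq_iff)
      then show ?thesis
        unfolding xyz(1) x y z list.map Phi_gens even[OF g] mB_3_even[OF g] by blast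
    qed
    have odd_case: ?thesis if x: "x = (0, f)" and y: "y = (b, 0)" and z: "z = (0, g)"
      and g: "b \<in> grade A q" "f \<in> grade (dual B) r" "g \<in> grade (dual B) s" for b f g q r s
    proof -
      have "mB 3 [(0, f), (\<phi> b, 0), (0, g)] \<in> summand EB 1"
        by (rule goodB(2)[OF _ homogeneous_gens(6)[OF g(2)]
              homogeneous_gens(5)[OF grade_\<phi>(1)[OF g(1)]] homogeneous_gens(6)[OF g(3)]]) simp_all
      then have "(0, snd (mB 3 [(0, f), (\<phi> b, 0), (0, g)])) = mB 3 [(0, f), (\<phi> b, 0), (0, g)]"
        by (simp add: ext_summand prod_eq_iff)
      then show ?thesis
        unfolding xyz(1) x y z list.map Phi_gens odd[OF g] mA_3_odd[OF g] by blast
    qed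
    obtain i j k where ijk: "i = 0 \<or> i = 1" "j = 0 \<or> j = 1" "k = 0 \<or> k = 1" "ty x i" "ty y j" "ty z k"
      using ty[OF xyz(2)] ty[OF xyz(3)] ty[OF xyz(4)] by blast
    consider "i = j \<or> j = k" | "i = 0" "j = 1" "k = 0" | "i = 1" "j = 0" "k = 1"
      using ijk by auto
    then show ?thesis
    proof cases
      case 1
      then show ?thesis using vanish[OF ijk(4-6)] ijk(1-3) by auto
    next
      case 2
      then obtain a b f p q r where "x = (a, 0)" "y = (0, f)" "z = (b, 0)"
        "a \<in> grade A p" "b \<in> grade A q" "f \<in> grade (dual B) r"
        using ijk unfolding ty_def by auto
      then show ?thesis by (rule even_case)
    next
      case 3
      then obtain b f g q r s where "x = (0, f)" "y = (b, 0)" "z = (0, g)"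
        "b \<in> grade A q" "f \<in> grade (dual B) r" "g \<in> grade (dual B) s"
        using ijk unfolding ty_def by auto
      then show ?thesis by (rule odd_case)
    qed
  qed
  have maps: "Phi_A \<phi> ` gcarrier E \<subseteq> gcarrier EA" "Phi_B \<phi> ` gcarrier E \<subseteq> gcarrier EB"
    using gmap_gcarrier[OF graded_E(1) Phi_A_gmap] gmap_gcarrier[OF graded_E(1) Phi_B_gmap] by auto
  have ma: "multiadditive 3 (gcarrier EA) (mA 3)" "multiadditive 3 (gcarrier EB) (mB 3)"
    using a_infinityD(2)[OF mA(1), of 3] a_infinityD(2)[OF mB(1), of 3]
    by (auto intro: multilinear_multiadditive)
  show "Phi_A \<phi> (m3 xs) = mA 3 (map (Phi_A \<phi>) xs)"
    by (rule multiadditive_ext[OF multiadditive_comp_left[OF multilinear_multiadditive[OF ml] Phi_add(1)]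
          multiadditive_comp_right[OF ma(1) Phi_add(1) maps(1)] gcarrier_gens _ xs])
      (use agree in blast)
  show "Phi_B \<phi> (m3 xs) = mB 3 (map (Phi_B \<phi>) xs)"
    by (rule multiadditive_ext[OF multiadditive_comp_left[OF multilinear_multiadditive[OF ml] Phi_add(2)]
          multiadditive_comp_right[OF ma(2) Phi_add(2) maps(2)] gcarrier_gens _ xs])
      (use agree in blast)
qed

lemma Phi_inj: "Phi_A \<phi> x = Phi_A \<phi> y \<Longrightarrow> Phi_B \<phi> x = Phi_B \<phi> y \<Longrightarrow> x = y"
  for x y :: "'a \<times> ('b \<Rightarrow> 'k)"
  by (metis Phi_A_simps(1) Phi_B_simps(2) prod_eqI)

text \<open>Strictness determines the images of a value under both maps, and together these
  determine the value.\<close>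

lemma m3_phi_unique:
  assumes "is_m3_phi d A B \<phi> mA mB m3" "is_m3_phi d A B \<phi> mA mB m3'"
    and "length xs = 3" "set xs \<subseteq> gcarrier E"
  shows "m3 xs = m3' xs"
  by (rule Phi_inj) (simp_all add: m3_phi_strict[OF assms(1,3,4)] m3_phi_strict[OF assms(2,3,4)])

text \<open>A single formula replaces a case distinction on patterns: each argument is projected to
  the summand that the alternating pattern requires. Multilinearity is then inherited, and in every
  other pattern some projected argument is zero.\<close>

lemma m3_phi_exists: "\<exists>m3. is_m3_phi d A B \<phi> mA mB m3"
proof
  \<comment> \<open>The maps \<open>a0\<close> and \<open>a1\<close> are the two coordinate
    projections followed by \<open>Phi_A\<close>, and \<open>b0\<close>, \<open>b1\<close> the same
    for \<open>Phi_B\<close>.\<close>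
  define a0 where "a0 x = (fst x, 0 :: 'a \<Rightarrow> 'k)" for x :: "'a \<times> ('b \<Rightarrow> 'k)"
  define a1 where "a1 x = (0 :: 'a, snd x \<circ> \<phi>)" for x :: "'a \<times> ('b \<Rightarrow> 'k)"
  define b0 where "b0 x = (\<phi> (fst x), 0 :: 'b \<Rightarrow> 'k)" for x :: "'a \<times> ('b \<Rightarrow> 'k)"
  define b1 where "b1 x = (0 :: 'b, snd x)" for x :: "'a \<times> ('b \<Rightarrow> 'k)"
  note defs = a0_def a1_def b0_def b1_def
  define m3 where "m3 xs = (fst (mA 3 [a0 (xs ! 0), a1 (xs ! 1), a0 (xs ! 2)]),
      snd (mB 3 [b1 (xs ! 0), b0 (xs ! 1), b1 (xs ! 2)]))" for xs
  have m3: "m3 [x, y, z] = (fst (mA 3 [a0 x, a1 y, a0 z]), snd (mB 3 [b1 x, b0 y, b1 z]))" for x y z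
    by (simp add: m3_def)
  have gc: "a0 x \<in> gcarrier EA" "a1 x \<in> gcarrier EA" "b0 x \<in> gcarrier EB" "b1 x \<in> gcarrier EB"
    if "x \<in> gcarrier E" for x
    using that gmap_gcarrier[OF dual_B \<phi>_dual]
    by (simp_all add: defs ext_gcarrier A_UNIV B_UNIV gcarrier_zero dual_A dual_B)
  have add: "a0 (x + y) = a0 x + a0 y" "a1 (x + y) = a1 x + a1 y"
    "b0 (x + y) = b0 x + b0 y" "b1 (x + y) = b1 x + b1 y" for x y
    by (auto simp: defs fun_eq_iff \<phi>_linear)
  have scl: "a0 (scl E c x) = scl EA c (a0 x)" "a1 (scl E c x) = scl EA c (a1 x)"
    "b0 (scl E c x) = scl EB c (b0 x)" "b1 (scl E c x) = scl EB c (b1 x)" for c x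
    by (auto simp: defs ext_scl fun_eq_iff \<phi>_linear graded_spaceD(6)[OF A(1)]
        graded_spaceD(6)[OF B(1)] dual_def)
  have mlA: "multilinear 3 EA EA (mA 3)" and mlB: "multilinear 3 EB EB (mB 3)"
    using a_infinityD(2)[OF mA(1)] a_infinityD(2)[OF mB(1)] by simp_all
  note TA = trilinearD[OF mlA] and TB = trilinearD[OF mlB]
  have m3_gc: "m3 [x, y, z] \<in> gcarrier E"
    if "x \<in> gcarrier E" "y \<in> gcarrier E" "z \<in> gcarrier E" for x y z
    using TB(1)[of "b1 x" "b0 y" "b1 z"] that gc by (simp add: m3 ext_gcarrier A_UNIV)
  have ml: "multilinear 3 E E m3"
  proof (rule trilinearI)
    have "scl E c (u, v) = (scl A c u, scl (dual B) c v)" "fst (scl EA c w) = scl A c (fst w)"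
      "snd (scl EB c w') = scl (dual B) c (snd w')" for c u v w w'
      by (simp_all add: ext_scl)
    then show "m3 [scl E c x, y, z] = scl E c (m3 [x, y, z]) \<and>
        m3 [x, scl E c y, z] = scl E c (m3 [x, y, z]) \<and> m3 [x, y, scl E c z] = scl E c (m3 [x, y, z])"
      if "x \<in> gcarrier E" "y \<in> gcarrier E" "z \<in> gcarrier E" for x y z c
      using that by (simp add: m3 scl gc TA TB)
  qed (simp_all add: m3_gc, simp_all add: m3 add gc TA TB)
  have zA: "mA 3 [x, y, z] = 0" if "x \<in> gcarrier EA" "y \<in> gcarrier EA" "z \<in> gcarrier EA"
    "x = 0 \<or> y = 0 \<or> z = 0" for x y z
    using TA(2)[of x y z x] TA(3)[of x y z y] TA(4)[of x y z z] that by auto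
  have zB: "mB 3 [x, y, z] = 0" if "x \<in> gcarrier EB" "y \<in> gcarrier EB" "z \<in> gcarrier EB"
    "x = 0 \<or> y = 0 \<or> z = 0" for x y z
    using TB(2)[of x y z x] TB(3)[of x y z y] TB(4)[of x y z z] that by auto
  have type0: "b1 x = 0" if "x \<in> summand E 0" for x
    using that by (simp add: ext_summand b1_def zero_prod_def)
  have type0': "a1 x = 0" if "x \<in> summand E 0" for x
    using that by (simp add: ext_summand a1_def prod_eq_iff fun_eq_iff)
  have type1: "a0 x = 0" "b0 x = 0" if "x \<in> summand E 1" for x
    using that by (simp_all add: ext_summand a0_def b0_def zero_prod_def \<phi>_linear)
  have good: "good_map E 3 m3"
    unfolding good_map_def
  proof (intro allI impI)
    fix js xs
    assume "length js = 3 \<and> set js \<subseteq> {0, 1} \<and> list_all2 (\<lambda>i x. x \<in> summand E i) js xs"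
    then obtain i j k x y z where js: "js = [i, j, k]" "{i, j, k} \<subseteq> {0, 1}" and
      xs: "xs = [x, y, z]" "x \<in> summand E i" "y \<in> summand E j" "z \<in> summand E k"
      by (auto simp: numeral_3_eq_3 length_Suc_conv list_all2_Cons1)
    have c: "x \<in> gcarrier E" "y \<in> gcarrier E" "z \<in> gcarrier E"
      using xs by (auto intro: summand_gcarrier)
    \<comment> \<open>The coordinate in A survives only for the pattern 0, 1, 0; for any other
      pattern one of its three arguments is zero. The dual coordinate behaves likewise for 1, 0,
      1.\<close>
    have A0: "fst (mA 3 [a0 x, a1 y, a0 z]) = 0" if "i = 1 \<or> j = 0 \<or> k = 1"
    proof -
      have "a0 x = 0 \<or> a1 y = 0 \<or> a0 z = 0" using that xs type0' type1(1) by metis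
      then show ?thesis using zA[OF gc(1)[OF c(1)] gc(2)[OF c(2)] gc(1)[OF c(3)]] by simp
    qed
    have B0: "snd (mB 3 [b1 x, b0 y, b1 z]) = 0" if "i = 0 \<or> j = 1 \<or> k = 0"
    proof -
      have "b1 x = 0 \<or> b0 y = 0 \<or> b1 z = 0" using that xs type0 type1(2) by metis
      then show ?thesis using zB[OF gc(4)[OF c(1)] gc(3)[OF c(2)] gc(4)[OF c(3)]] by simp
    qed
    have ijk: "i = 0 \<or> i = 1" "j = 0 \<or> j = 1" "k = 0 \<or> k = 1" using js(2) by auto
    show "if alternating js then m3 xs \<in> summand E (hd js) else m3 xs = 0"
    proof (cases "alternating js")
      case True
      then have "i \<noteq> j" "j \<noteq> k" by (simp_all add: js alternating3)
      then have "m3 xs \<in> summand E i"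
        using m3_gc[OF c] ijk A0 B0 by (auto simp: summand_def xs(1) m3)
      then show ?thesis using True by (simp add: js)
    next
      case False
      then have "i = j \<or> j = k" by (simp add: js alternating3)
      then have "m3 xs = 0"
        using ijk A0 B0 by (auto simp: xs(1) m3 zero_prod_def)
      then show ?thesis using False by simp
    qed
  qed
  show "is_m3_phi d A B \<phi> mA mB m3"
    unfolding is_m3_phi_def
  proof (intro conjI allI ballI ml good)
    fix p q r a b f assume g: "a \<in> grade A p" "b \<in> grade A q" "f \<in> grade (dual B) r"
    note s = homogeneous_gens(1)[OF g(1)] homogeneous_gens(2)[OF g(3)] homogeneous_gens(1)[OF g(2)]
    have "snd (mB 3 [b1 (a, 0), b0 (0, f), b1 (b, 0)]) = 0"
      by (subst zB) (auto intro: gc summand_gcarrier[OF s(1)] summand_gcarrier[OF s(2)]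
          summand_gcarrier[OF s(3)] type0 s)
    then show "m3 [(a, 0), (0, f), (b, 0)] = (fst (mA 3 [(a, 0), (0, f \<circ> \<phi>), (b, 0)]), 0)"
      unfolding m3 by (simp add: a0_def a1_def)
  next
    fix q r s b f g assume g: "b \<in> grade A q" "f \<in> grade (dual B) r" "g \<in> grade (dual B) s"
    note s = homogeneous_gens(2)[OF g(2)] homogeneous_gens(1)[OF g(1)] homogeneous_gens(2)[OF g(3)]
    have "fst (mA 3 [a0 (0, f), a1 (b, 0), a0 (0, g)]) = 0"
      by (subst zA) (auto intro: gc summand_gcarrier[OF s(1)] summand_gcarrier[OF s(2)]
          summand_gcarrier[OF s(3)] type1 s)
    then show "m3 [(0, f), (b, 0), (0, g)] = (0, snd (mB 3 [(0, f), (\<phi> b, 0), (0, g)]))"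
      unfolding m3 by (simp add: b0_def b1_def)
  qed
qed

end

section \<open>Dg algebra axioms extracted from the relations of low arity\<close>

lemma vanishes_nice: "nice V m \<Longrightarrow> n \<ge> 4 \<Longrightarrow> length xs = n \<Longrightarrow> set xs \<subseteq> gcarrier V \<Longrightarrow> m n xs = 0"
  by (simp add: nice_def small_def vanishes_def)

lemma a_infinity_mul_add:
  assumes "a_infinity V m" "x \<in> gcarrier V" "y \<in> gcarrier V" "z \<in> gcarrier V"
  shows "m 2 [x, y] \<in> gcarrier V" "m 2 [x + y, z] = m 2 [x, z] + m 2 [y, z]"
    "m 2 [x, y + z] = m 2 [x, y] + m 2 [x, z]" "m 1 [x] \<in> gcarrier V"
    "m 1 [x + y] = m 1 [x] + m 1 [y]"
  using assms(2-) multilinearD(1)[OF a_infinityD(2)[OF assms(1)], of 2 "[x, y]"]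
    multilinearD(2)[OF a_infinityD(2)[OF assms(1)], of 2 "[x, z]" 0 y]
    multilinearD(2)[OF a_infinityD(2)[OF assms(1)], of 2 "[x, y]" 1 z]
    multilinearD(1)[OF a_infinityD(2)[OF assms(1)], of 1 "[x]"]
    multilinearD(2)[OF a_infinityD(2)[OF assms(1)], of 1 "[x]" 0 y]
  by simp_all

lemma a_infinity_dif_dif:
  assumes m: "a_infinity V m" and x: "x \<in> grade V n"
  shows "m 1 [m 1 [x]] = 0"
proof -
  have "{(r, s, t). r + s + t = 1 \<and> s \<ge> 1} = {(0, 1, 0 :: nat)}"
    by auto
  then show ?thesis
    using a_infinity_stasheff[OF m, of 1 "[x]" "[n]"] x by (simp add: stasheff_term_def homog_def sg_def)
qed

lemma a_infinity_leibniz: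
  assumes m: "a_infinity V m" and x: "x \<in> grade V p" "y \<in> grade V q"
  shows "m 1 [m 2 [x, y]] = m 2 [m 1 [x], y] + sg p (m 2 [x, m 1 [y]])"
proof -
  \<comment> \<open>The three terms have signs -1, -1 and +1, and the middle one also carries the
    Koszul sign of the differential passing x. Solving for the last term gives the Leibniz
    rule.\<close>
  have "{(r, s, t). r + s + t = 2 \<and> s \<ge> 1} = {(0, 1, 1 :: nat), (1, 1, 0), (0, 2, 0)}"
    by auto
  then show ?thesis
    using a_infinity_stasheff[OF m, of 2 "[x, y]" "[p, q]"] x
    by (simp add: stasheff_term_def homog_def numeral_2_eq_2) (simp add: sg_def algebra_simps split: if_splits)
qed

text \<open>Arities one and two yield the square-zero and Leibniz conditions. The relation of arity
  three also contains the ternary operation and the differential, so associativity is supplied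
  separately.\<close>

lemma fully_manageableI:
  assumes m: "a_infinity V m"
    and assoc: "\<And>p q x y z. x \<in> grade V p \<Longrightarrow> y \<in> grade V q \<Longrightarrow> z \<in> gcarrier V \<Longrightarrow>
      m 2 [m 2 [x, y], z] = m 2 [x, m 2 [y, z]]"
  shows "fully_manageable V m"
  unfolding fully_manageable_def dg_algebra_def
proof (intro conjI allI ballI)
  note V = a_infinityD(1)[OF m] and madd = a_infinity_mul_add[OF m]
  note gc = grade_subset_gcarrier[OF V]
  have z0: "0 \<in> gcarrier V" by (rule gcarrier_zero[OF V])
  have d0: "m 1 [0] = 0" using madd(5)[OF z0 z0 z0] by simp
  have m0: "m 2 [0, x] = 0" "m 2 [x, 0] = 0" if "x \<in> gcarrier V" for x
    using madd(2)[OF z0 z0 that] madd(3)[OF that z0 z0] by simp_all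
  have list2: "length xs = 2 \<Longrightarrow> xs = [xs ! 0, xs ! 1]" for xs :: "'b list"
    by (auto simp: length_Suc_conv numeral_2_eq_2)
  have ml: "multilinear 2 V V (m 2)" "has_degree 2 0 V V (m 2)" "multilinear 1 V V (m 1)" "has_degree 1 1 V V (m 1)"
    using a_infinityD(2,3)[OF m, of 2] a_infinityD(2,3)[OF m, of 1] by simp_all
  show "graded_space V" by fact
  show "gmap 1 V V (\<lambda>x. m 1 [x])"
    unfolding gmap_def
  proof (intro conjI ballI allI subsetI)
    show "m 1 [scl V c x] = scl V c (m 1 [x])" if "x \<in> gcarrier V" for c x
      using multilinearD(3)[OF ml(3), of "[x]" 0 c] that by simp
    show "y \<in> grade V (n + 1)" if y: "y \<in> (\<lambda>x. m 1 [x]) ` grade V n" for n y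
    proof -
      obtain x where x: "y = m 1 [x]" "x \<in> grade V n" using y by blast
      then have "homog V [n] [x]" by (simp add: homog_def)
      then have "m 1 [x] \<in> grade V (sum_list [n] + 1)"
        using ml(4) unfolding has_degree_def by (metis length_Cons list.size(3) One_nat_def)
      then show ?thesis using x by simp
    qed
  qed (use madd in auto)
  show "multilinear 2 V V (\<lambda>xs. m 2 [xs ! 0, xs ! 1])"
    using ml(1) unfolding multilinear_def by (metis list2 length_list_update)
  show "has_degree 2 0 V V (\<lambda>xs. m 2 [xs ! 0, xs ! 1])"
    using ml(2) unfolding has_degree_def by (metis list2)
  show "m 1 [m 1 [x]] = 0" if "x \<in> gcarrier V" for x
    using V that
  proof (induction rule: gcarrier_sum_induct)
    case (add n x y)
    then show ?case
      using madd(5)[OF gc[OF add(1)] add(2) z0] madd(4)[OF gc[OF add(1)] z0 z0] madd(4)[OF add(2) z0 z0]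
        a_infinity_dif_dif[OF m add(1)] madd(5)[of "m 1 [x]" "m 1 [y]" 0] z0
      by simp
  qed (simp add: d0[unfolded One_nat_def])
  show "m 2 [m 2 [x, y], z] = m 2 [x, m 2 [y, z]]"
    if "x \<in> gcarrier V" "y \<in> gcarrier V" "z \<in> gcarrier V" for x y z
    using V that(1)
  proof (induction rule: gcarrier_sum_induct)
    case zero
    show ?case by (simp add: m0 m0(1)[OF madd(1)[OF that(2,3) z0]] that)
  next
    case (add p x x')
    \<comment> \<open>A second induction, on y, with the homogeneous summand x of the outer one
      fixed. The assumed associativity allows any z in the carrier, so no third induction
      follows.\<close>
    have "m 2 [m 2 [x, y], z] = m 2 [x, m 2 [y, z]]"
      using V that(2)
    proof (induction rule: gcarrier_sum_induct)
      case zero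
      show ?case using gc[OF add(1)] by (simp add: m0 that)
    next
      case (add q y y')
      note g = gc[OF \<open>x \<in> grade V p\<close>] gc[OF add(1)] add(2) that(3)
      have "m 2 [m 2 [x, y + y'], z] = m 2 [m 2 [x, y], z] + m 2 [m 2 [x, y'], z]"
        using g by (simp add: madd(3) madd(2)[OF madd(1) madd(1)])
      moreover have "m 2 [x, m 2 [y + y', z]] = m 2 [x, m 2 [y, z]] + m 2 [x, m 2 [y', z]]"
        using g by (simp add: madd(2) madd(3)[OF _ madd(1) madd(1)])
      ultimately show ?case using assoc[OF \<open>x \<in> grade V p\<close> add(1) that(3)] add(3) by simp
    qed
    moreover have "m 2 [m 2 [x + x', y], z] = m 2 [m 2 [x, y], z] + m 2 [m 2 [x', y], z]"
      using gc[OF add(1)] add(2) that by (simp add: madd(2) madd(2)[OF madd(1) madd(1)])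
    moreover have "m 2 [x + x', m 2 [y, z]] = m 2 [x, m 2 [y, z]] + m 2 [x', m 2 [y, z]]"
      using gc[OF add(1)] add(2) that by (simp add: madd(2)[OF _ _ madd(1)])
    ultimately show ?case using add(3) by simp
  qed
  show "m 1 [m 2 [x, y]] = m 2 [m 1 [x], y] + sg p (m 2 [x, m 1 [y]])"
    if x: "x \<in> grade V p" and y: "y \<in> gcarrier V" for p x y
    using V y
  proof (induction rule: gcarrier_sum_induct)
    case zero
    show ?case using gc[OF x] madd(4)[OF gc[OF x] z0 z0] by (simp add: m0 d0 del: One_nat_def)
  next
    case (add q y y')
    note g = gc[OF x] gc[OF add(1)] add(2)
    have "m 1 [m 2 [x, y + y']] = m 1 [m 2 [x, y]] + m 1 [m 2 [x, y']]"
      using madd(3)[OF g] madd(5)[OF madd(1)[OF g(1,2) z0] madd(1)[OF g(1,3) z0] z0] by simp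
    moreover have "m 2 [m 1 [x], y + y'] = m 2 [m 1 [x], y] + m 2 [m 1 [x], y']"
      using madd(3)[OF madd(4)[OF g(1) z0 z0] g(2,3)] by simp
    moreover have "m 2 [x, m 1 [y + y']] = m 2 [x, m 1 [y]] + m 2 [x, m 1 [y']]"
      using madd(5)[OF g(2,3) z0] madd(3)[OF g(1) madd(4)[OF g(2) z0 z0] madd(4)[OF g(3) z0 z0]] by simp
    ultimately show ?case
      using a_infinity_leibniz[OF m x add(1)] add(3) by (simp add: sg_add algebra_simps)
  qed
qed

lemma double_poisson_dg_algebraD:
  assumes "double_poisson_dg_algebra d A \<mu> \<delta> br"
  shows "gcarrier A = UNIV" "dg_algebra A \<mu> \<delta>" "br a b \<in> tensors 2"
proof -
  show "gcarrier A = UNIV" "dg_algebra A \<mu> \<delta>"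
    using assms by (simp_all add: double_poisson_dg_algebra_def)
  have "double_poisson_bracket d A \<mu> \<delta> br"
    using assms by (simp add: double_poisson_dg_algebra_def)
  then have "\<forall>a b. br a b \<in> tensors 2"
    unfolding double_poisson_bracket_def Let_def by (rule conjunct1)
  then show "br a b \<in> tensors 2" by blast
qed

section \<open>Assembling the structure on the extension\<close>

context double_poisson_extension
begin

abbreviation "m m3 \<equiv> m_phi d A \<mu>A \<delta>A B \<mu>B \<delta>B \<phi> m3"

lemma m_phi_values:
  "m m3 1 [x] = dif x" "m m3 2 [x, y] = mul x y" "m m3 3 xs = m3 xs" "n \<ge> 4 \<Longrightarrow> m m3 n xs = 0"
  by (simp_all add: m_phi_def)

lemma arity_cases:
  fixes n :: nat
  assumes "n \<ge> 1" "length xs = n"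
  obtains x where "n = 1" "xs = [x]" | x y where "n = 2" "xs = [x, y]" | "n = 3" | "n \<ge> 4"
proof -
  have "n = 1 \<or> n = 2 \<or> n = 3 \<or> n \<ge> 4" using assms(1) by linarith
  then show thesis using assms(2) that by (auto simp: length_Suc_conv numeral_2_eq_2)
qed

text \<open>Arities one and two compare differentials and products, arity three compares the ternary
  operations, and from arity four on both sides vanish because the nice structures on A and B are
  small.\<close>

lemma Phi_strict:
  assumes m3: "is_m3_phi d A B \<phi> mA mB m3"
  shows "strict_morphism E (m m3) EA mA (Phi_A \<phi>)" "strict_morphism E (m m3) EB mB (Phi_B \<phi>)"
proof -
  have Phi0: "Phi_A \<phi> (0 :: 'a \<times> ('b \<Rightarrow> 'k)) = 0" "Phi_B \<phi> (0 :: 'a \<times> ('b \<Rightarrow> 'k)) = 0"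
    by (simp_all add: prod_eq_iff \<phi>_linear fun_eq_iff)
  have gc: "Phi_A \<phi> x \<in> gcarrier EA" "Phi_B \<phi> x \<in> gcarrier EB" if "x \<in> gcarrier E" for x
    using that gmap_gcarrier[OF graded_E(1) Phi_A_gmap] gmap_gcarrier[OF graded_E(1) Phi_B_gmap] by auto
  have "Phi_A \<phi> (m m3 n xs) = mA n (map (Phi_A \<phi>) xs) \<and> Phi_B \<phi> (m m3 n xs) = mB n (map (Phi_B \<phi>) xs)"
    if n: "n \<ge> 1" and xs: "length xs = n" "set xs \<subseteq> gcarrier E" for n xs
    using n xs(1)
  proof (cases rule: arity_cases)
    case (1 x)
    then show ?thesis
      using xs(2) gc mA(4)[of "Phi_A \<phi> x"] mB(4)[of "Phi_B \<phi> x"] m_phi_values(1)[of m3 x]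
        Phi_A_dif[of x] Phi_B_dif[of x] by simp
  next
    case (2 x y)
    then show ?thesis
      using xs(2) gc by (simp add: m_phi_values(2) mA(5) mB(5) Phi_A_mul Phi_B_mul)
  next
    case 3
    then show ?thesis using xs m3_phi_strict[OF m3] by (simp add: m_phi_values(3))
  next
    case 4
    then show ?thesis
      using xs gc vanishes_nice[OF mA(2) 4, of "map (Phi_A \<phi>) xs"]
        vanishes_nice[OF mB(2) 4, of "map (Phi_B \<phi>) xs"]
      by (simp add: m_phi_values(4) Phi0 image_subset_iff subset_eq)
  qed
  then show "strict_morphism E (m m3) EA mA (Phi_A \<phi>)" "strict_morphism E (m m3) EB mB (Phi_B \<phi>)"
    using Phi_A_gmap Phi_B_gmap by (auto simp: strict_morphism_def)
qed

text \<open>Carriers and grades are reflected coordinatewise: \<open>Phi_A\<close> detects the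
  coordinate in A and \<open>Phi_B\<close> the one in the dual of B.\<close>

lemma m_phi_a_infinity:
  assumes "is_m3_phi d A B \<phi> mA mB m3"
  shows "a_infinity E (m m3)"
proof -
  interpret jointly_embedded E EA EB "m m3" mA mB "Phi_A \<phi>" "Phi_B \<phi>"
    by unfold_locales
      (use graded_E Phi_strict[OF assms] Phi_add Phi_inj mA(1) mB(1) in
        \<open>auto simp: ext_gcarrier ext_grade\<close>)
  show ?thesis by (rule a_infinity)
qed

text \<open>In arity one goodness means that the differential preserves both summands, which holds
  since it acts coordinatewise. Arity three is part of the hypothesis on \<open>m3\<close>, and all
  operations of arity four or more vanish, among them the even ones that must.\<close>

lemma m_phi_nice:
  assumes "is_m3_phi d A B \<phi> mA mB m3"
  shows "nice E (m m3)"
proof -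
  have "good_map E n (m m3 n)" if n: "odd n" for n
  proof -
    consider "n = 1" | "n = 3" | "n \<ge> 4" using n by (auto elim!: oddE) arith
    then show ?thesis
    proof cases
      case 1
      have "m m3 1 [x] \<in> summand E i" if "i \<in> {0, 1}" "x \<in> summand E i" for i x
        using that a_infinity_mul_add(4)[OF m_phi_a_infinity[OF assms] summand_gcarrier[OF that(2)]]
          gcarrier_zero[OF graded_E(1)]
        by (auto simp: m_phi_values(1)[unfolded One_nat_def] ext_dif_def summand_def A(3) dual_dif_def dual_B shift_dif_def)
      then show ?thesis
        unfolding 1 good_map_def by (auto simp: length_Suc_conv alternating_def list_all2_Cons1)
    next
      case 2
      have "m m3 3 = m3" by (simp add: fun_eq_iff m_phi_values(3))
      then show ?thesis using assms unfolding 2 is_m3_phi_def by simp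
    next
      case 3
      then show ?thesis
        using gcarrier_zero[OF graded_E(1)] by (auto simp: good_map_def m_phi_values(4) summand_def)
    qed
  qed
  then show ?thesis
    by (auto simp: nice_def good_def small_def essentially_odd_def vanishes_def m_phi_values(4))
qed

text \<open>Associativity comes from the explicit product. The relations are used only to know that
  the product of y and z stays in the carrier and for the remaining dg algebra axioms.\<close>

lemma m_phi_fully_manageable:
  assumes "is_m3_phi d A B \<phi> mA mB m3"
  shows "fully_manageable E (m m3)"
proof (rule fully_manageableI[OF m_phi_a_infinity[OF assms]])
  fix p q x y z assume x: "x \<in> grade E p" and y: "y \<in> grade E q" and z: "z \<in> gcarrier E"
  have "mul y z \<in> gcarrier E"
    using a_infinity_mul_add(1)[OF m_phi_a_infinity[OF assms] grade_subset_gcarrier[OF graded_E(1) y] z z]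
    by (simp add: m_phi_values(2))
  then show "m m3 2 [m m3 2 [x, y], z] = m m3 2 [x, m m3 2 [y, z]]"
    unfolding m_phi_values(2) by (rule mul_assoc_homogeneous[OF x y z])
qed

lemma m_phi_degenerate_cyclic:
  assumes "is_m3_phi d A B \<phi> mA mB m3"
  shows "degenerate_cyclic (d - 1) E (m m3) \<gamma>"
  using mA(3) unfolding cyclic_structure_def
  by (intro degenerate_cyclic_pullback[where \<gamma>' = \<gamma>A, OF m_phi_a_infinity[OF assms]
        Phi_strict(1)[OF assms] form_Phi_A]) auto

end

theorem theorem5p6:
  fixes d :: int
    and A :: "('k::field_char_0, 'a::ab_group_add) gvs"
    and B :: "('k, 'b::ab_group_add) gvs"
    and \<mu>A :: "'a \<Rightarrow> 'a \<Rightarrow> 'a" and \<delta>A :: "'a \<Rightarrow> 'a" and brA :: "'a \<Rightarrow> 'a \<Rightarrow> ('k, 'a) fsum"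
    and \<mu>B :: "'b \<Rightarrow> 'b \<Rightarrow> 'b" and \<delta>B :: "'b \<Rightarrow> 'b" and brB :: "'b \<Rightarrow> 'b \<Rightarrow> ('k, 'b) fsum"
    and \<phi> :: "'a \<Rightarrow> 'b"
    and mA :: "nat \<Rightarrow> ('a \<times> ('a \<Rightarrow> 'k)) list \<Rightarrow> 'a \<times> ('a \<Rightarrow> 'k)"
    and mB :: "nat \<Rightarrow> ('b \<times> ('b \<Rightarrow> 'k)) list \<Rightarrow> 'b \<times> ('b \<Rightarrow> 'k)"
  assumes "double_poisson_dg_algebra d A \<mu>A \<delta>A brA"
    and "double_poisson_dg_algebra d B \<mu>B \<delta>B brB"
    and "double_poisson_morphism A \<mu>A \<delta>A brA B \<mu>B \<delta>B brB \<phi>"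
    and "corresponding_structure d A \<mu>A \<delta>A brA mA"
    and "corresponding_structure d B \<mu>B \<delta>B brB mB"
  shows
    "(\<exists>m3. is_m3_phi d A B \<phi> mA mB m3) \<and>
     (\<forall>m3 m3'. is_m3_phi d A B \<phi> mA mB m3 \<and> is_m3_phi d A B \<phi> mA mB m3' \<longrightarrow>
        (\<forall>xs. length xs = 3 \<and> set xs \<subseteq> gcarrier (ext_space d A B) \<longrightarrow> m3 xs = m3' xs)) \<and>
     (\<forall>m3. is_m3_phi d A B \<phi> mA mB m3 \<longrightarrow>
       (let E = ext_space d A B;
            m = m_phi d A \<mu>A \<delta>A B \<mu>B \<delta>B \<phi> m3;
            \<gamma> = ext_form d A B \<phi>
        in a_infinity E m \<and> fully_manageable E m \<and> nice E m \<and> degenerate_cyclic (d - 1) E m \<gamma> \<and>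
           strict_morphism E m (ext_space d A A) mA (Phi_A \<phi>) \<and>
           strict_morphism E m (ext_space d B B) mB (Phi_B \<phi>) \<and>
           (\<forall>x\<in>gcarrier E. \<forall>y\<in>gcarrier E.
              \<gamma> x y = ext_form d A A id (Phi_A \<phi> x) (Phi_A \<phi> y) \<and>
              \<gamma> x y = ext_form d B B id (Phi_B \<phi> x) (Phi_B \<phi> y))))"
proof -
  interpret double_poisson_extension d A \<mu>A \<delta>A B \<mu>B \<delta>B \<phi> brA brB mA mB
    using double_poisson_dg_algebraD[OF assms(1)] double_poisson_dg_algebraD[OF assms(2)] assms(3-5)
    by unfold_locales (simp_all add: double_poisson_morphism_def)
  show ?thesis
    unfolding Let_def
    using m3_phi_exists m3_phi_unique m_phi_a_infinity m_phi_fully_manageable m_phi_nice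
      m_phi_degenerate_cyclic Phi_strict form_Phi_A form_Phi_B
    by (intro conjI allI impI ballI) blast+
qed

end
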